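(* (i) For every stump $\sigma$ and all $\delta,\alpha\in\mathcal N$, if $\sigma$ secures that $\alpha$ belongs to $\mathit{Almost}^\ast(En_\delta)$, then $\alpha\in\mathbb P(\sigma,En_\delta)$. (ii) For all $\delta,\alpha$, if $\alpha\in\mathit{Almost}^\ast(En_\delta)$, then there exists a stump $\sigma$ such that $\alpha\in\mathbb P(\sigma,En_\delta)$. (iii) For all $\delta$, the set $\mathit{Almost}^\ast(En_\delta)$ coincides with $\bigcup_{\sigma\in\mathbf{Stp}}\mathbb P(\sigma,En_\delta)$. (iv) For all $\beta,\delta$: if for every $s$, $\beta(s)=0$ iff $\beta(s*\langle n\rangle)=0$ for some $n$, and $F_\beta\subseteq\mathit{Almost}^\ast(En_\delta)$, then there exists a stump $\tau$ with $F_\beta\subseteq\mathbb P(\tau,En_\delta)$. (v) The set $\mathbf{ACS}$ coincides with $\bigcup_{\sigma\in\mathbf{Stp}}\mathbf{PCS}_\sigma$.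
   Context: Framework: Brouwer's intuitionistic analysis (intuitionistic logic, countable choice, Brouwer's Continuity Principle, axioms of continuous choice, Brouwer's Thesis on Bars, Fan Theorem). $\mathcal N=\mathbb N^{\mathbb N}$; finite sequences coded by numbers ($\langle\,\rangle=0$), $\overline\alpha n$ initial part of length $n$, $\overline si$ initial part of $s$ of length $i$, $*$ concatenation, $\alpha^m(k)=\alpha(\langle m\rangle*k)$; $\alpha\#\beta$ iff $\exists n\,\alpha(n)\neq\beta(n)$. $F_\beta=\{\alpha:\forall n\,\beta(\overline\alpha n)=0\}$. Stumps: $\mathbf{Stp}$ is the least set containing every $\sigma$ with $\sigma(0)\ne0$ (empty stumps) and containing $\sigma$ whenever $\sigma(0)=0$ and all $\sigma^n\in\mathbf{Stp}$; $\sigma$ admits $s$ iff $\sigma(\overline si)=0$ for all $i\le\mathit{length}(s)$. $En_\delta=\{\delta^n:n\in\mathbb N\}$. $\mathit{Almost}^\ast(En_\delta)$ = set of $\alpha$ such that for every $\gamma$ there is $n$ with $\overline\alpha(\gamma(n))=\overline{\delta^n}(\gamma(n))$. $\sigma$ secures that $\alpha\in\mathit{Almost}^\ast(En_\delta)$ iff for every $\gamma$ there is $n$ such that $\overline\gamma(n+1)$ is admitted by $\sigma$ and $\overline\alpha(\gamma(n))=\overline{\delta^n}(\gamma(n))$. Perhapsive extensions, by induction on stumps: $\mathbb P(\sigma,X)=X$ if $\sigma$ is empty; for non-empty $\sigma$, $\mathbb P(\sigma,X)$ is the set of $\alpha$ for which there is $\beta\in X$ such that if $\alpha\#\beta$ then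 $\alpha\in\mathbb P(\sigma^m,X)$ for some $m$. $\beta$ is a spread-law iff $\forall s[\beta(s)=0\leftrightarrow\exists n\,\beta(s*\langle n\rangle)=0]$. $\mathbf{PCS}_\sigma$ = set of spread-laws $\beta$ such that $F_\beta\subseteq\mathbb P(\sigma,En_\delta)$ for some $\delta$; $\mathbf{ACS}$ = set of spread-laws $\beta$ such that $F_\beta\subseteq\mathit{Almost}^\ast(En_\delta)$ for some $\delta$. *)

theory Defs
  imports Main "HOL-Library.Nat_Bijection"
begin

text \<open>
  The mathematics formalised here is intuitionistic; read in the classical logic of HOL it
  collapses (one gets \<open>Almost\<^sup>* (En \<delta>) = En \<delta>\<close> and \<open>\<P>(\<sigma>, X) = X\<close> for inhabited \<open>X\<close>).
  Statements are therefore interpreted with truth values in an arbitrary complete Heyting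
  algebra \<open>'h\<close>, i.e. in the internal higher-order intuitionistic logic of \<open>'h\<close>-valued sets: the
  natural numbers are the standard ones, number quantifiers are infima and suprema over them,
  and an element of Baire space is a total and single-valued \<open>'h\<close>-valued relation on the numbers.
\<close>

class complete_heyting_algebra = complete_lattice +
  assumes inf_Sup_le: "inf a (Sup B) \<le> Sup (inf a ` B)"

section \<open>Intuitionistic connectives and quantifiers\<close>

definition valid :: "'h::complete_heyting_algebra \<Rightarrow> bool" where
  "valid p \<longleftrightarrow> p = top"

definition tv :: "bool \<Rightarrow> 'h::complete_heyting_algebra" where
  "tv b = (if b then top else bot)"

abbreviation hconj :: "'h::complete_heyting_algebra \<Rightarrow> 'h \<Rightarrow> 'h" (infixr "\<^bold>\<and>" 35) where
  "p \<^bold>\<and> q \<equiv> inf p q"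

abbreviation hdisj :: "'h::complete_heyting_algebra \<Rightarrow> 'h \<Rightarrow> 'h" (infixr "\<^bold>\<or>" 30) where
  "p \<^bold>\<or> q \<equiv> sup p q"

definition himp :: "'h::complete_heyting_algebra \<Rightarrow> 'h \<Rightarrow> 'h" (infixr "\<^bold>\<longrightarrow>" 25) where
  "(p \<^bold>\<longrightarrow> q) = Sup {r. inf r p \<le> q}"

definition hiff :: "'h::complete_heyting_algebra \<Rightarrow> 'h \<Rightarrow> 'h" (infixr "\<^bold>\<longleftrightarrow>" 25) where
  "(p \<^bold>\<longleftrightarrow> q) = ((p \<^bold>\<longrightarrow> q) \<^bold>\<and> (q \<^bold>\<longrightarrow> p))"

definition hall :: "('a \<Rightarrow> 'h::complete_heyting_algebra) \<Rightarrow> 'h" (binder "\<^bold>\<forall>" 10) where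
  "(\<^bold>\<forall>x. \<phi> x) = (INF x. \<phi> x)"

definition hex :: "('a \<Rightarrow> 'h::complete_heyting_algebra) \<Rightarrow> 'h" (binder "\<^bold>\<exists>" 10) where
  "(\<^bold>\<exists>x. \<phi> x) = (SUP x. \<phi> x)"

lemma le_himp_iff: "r \<le> (p \<^bold>\<longrightarrow> q) \<longleftrightarrow> inf r p \<le> q"
proof
  assume "r \<le> (p \<^bold>\<longrightarrow> q)"
  then have "inf r p \<le> inf p (Sup {r. inf r p \<le> q})"
    unfolding himp_def by (metis inf.commute inf_mono order_refl)
  also have "\<dots> \<le> Sup (inf p ` {r. inf r p \<le> q})"
    by (rule inf_Sup_le)
  also have "\<dots> \<le> q"
    by (rule Sup_least) (auto simp: inf.commute)
  finally show "inf r p \<le> q" .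
next
  assume "inf r p \<le> q"
  then show "r \<le> (p \<^bold>\<longrightarrow> q)"
    unfolding himp_def by (simp add: Sup_upper)
qed

section \<open>Baire space\<close>

text \<open>\<open>\<alpha> n m\<close> is the truth value of \<open>\<alpha>(n) = m\<close>.\<close>

type_synonym 'h seq = "nat \<Rightarrow> nat \<Rightarrow> 'h"

definition baire :: "'h::complete_heyting_algebra seq \<Rightarrow> 'h" where
  "baire \<alpha> = ((\<^bold>\<forall>n. \<^bold>\<exists>m. \<alpha> n m) \<^bold>\<and> (\<^bold>\<forall>n m m'. \<alpha> n m \<^bold>\<and> \<alpha> n m' \<^bold>\<longrightarrow> tv (m = m')))"

definition sall :: "('h::complete_heyting_algebra seq \<Rightarrow> 'h) \<Rightarrow> 'h" (binder "\<^bold>\<forall>\<N>" 10) where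
  "(\<^bold>\<forall>\<N> \<alpha>. \<phi> \<alpha>) = (\<^bold>\<forall>\<alpha>. baire \<alpha> \<^bold>\<longrightarrow> \<phi> \<alpha>)"

definition sex :: "('h::complete_heyting_algebra seq \<Rightarrow> 'h) \<Rightarrow> 'h" (binder "\<^bold>\<exists>\<N>" 10) where
  "(\<^bold>\<exists>\<N> \<alpha>. \<phi> \<alpha>) = (\<^bold>\<exists>\<alpha>. baire \<alpha> \<^bold>\<and> \<phi> \<alpha>)"

definition seq_eq :: "'h::complete_heyting_algebra seq \<Rightarrow> 'h seq \<Rightarrow> 'h" where
  "seq_eq \<alpha> \<beta> = (\<^bold>\<forall>n. \<^bold>\<exists>m. \<alpha> n m \<^bold>\<and> \<beta> n m)"

definition apart :: "'h::complete_heyting_algebra seq \<Rightarrow> 'h seq \<Rightarrow> 'h" where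
  "apart \<alpha> \<beta> = (\<^bold>\<exists>n m m'. \<alpha> n m \<^bold>\<and> \<beta> n m' \<^bold>\<and> tv (m \<noteq> m'))"

text \<open>
  The bijection \<open>list_encode\<close> codes finite sequences by numbers (the empty one by 0), so
  quantifying over coded finite sequences is quantifying over \<open>nat list\<close>. Below, \<open>zero_at \<beta> s\<close>
  and \<open>nonzero_at \<beta> s\<close> stand for \<open>\<beta>(s) = 0\<close> and \<open>\<beta>(s) \<noteq> 0\<close>.
\<close>

definition zero_at :: "'h::complete_heyting_algebra seq \<Rightarrow> nat list \<Rightarrow> 'h" where
  "zero_at \<beta> s = \<beta> (list_encode s) 0"

definition nonzero_at :: "'h::complete_heyting_algebra seq \<Rightarrow> nat list \<Rightarrow> 'h" where
  "nonzero_at \<beta> s = (\<^bold>\<exists>m. tv (m \<noteq> 0) \<^bold>\<and> \<beta> (list_encode s) m)"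

text \<open>\<open>subseq \<alpha> m\<close> is \<open>\<alpha>\<^sup>m\<close>.\<close>

definition subseq :: "'h::complete_heyting_algebra seq \<Rightarrow> nat \<Rightarrow> 'h seq" where
  "subseq \<alpha> m = (\<lambda>k. \<alpha> (list_encode (m # list_decode k)))"

text \<open>\<open>init \<alpha> n s\<close>: the initial part of \<open>\<alpha>\<close> of length \<open>n\<close> is \<open>s\<close>.\<close>

definition init :: "'h::complete_heyting_algebra seq \<Rightarrow> nat \<Rightarrow> nat list \<Rightarrow> 'h" where
  "init \<alpha> n s = (tv (length s = n) \<^bold>\<and> (\<^bold>\<forall>i. tv (i < n) \<^bold>\<longrightarrow> \<alpha> i (s ! i)))"

definition same_init :: "'h::complete_heyting_algebra seq \<Rightarrow> 'h seq \<Rightarrow> nat \<Rightarrow> 'h" where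
  "same_init \<alpha> \<beta> n = (\<^bold>\<exists>s. init \<alpha> n s \<^bold>\<and> init \<beta> n s)"

definition F_set :: "'h::complete_heyting_algebra seq \<Rightarrow> 'h seq \<Rightarrow> 'h" where
  "F_set \<beta> \<alpha> = (\<^bold>\<forall>n. \<^bold>\<exists>s. init \<alpha> n s \<^bold>\<and> zero_at \<beta> s)"

definition En :: "'h::complete_heyting_algebra seq \<Rightarrow> 'h seq \<Rightarrow> 'h" where
  "En \<delta> \<alpha> = (\<^bold>\<exists>n. seq_eq \<alpha> (subseq \<delta> n))"

section \<open>Stumps and Brouwer's Thesis on Bars\<close>

definition stump_step :: "('h::complete_heyting_algebra seq \<Rightarrow> 'h) \<Rightarrow> 'h seq \<Rightarrow> 'h" where
  "stump_step S \<sigma> = (nonzero_at \<sigma> [] \<^bold>\<or> (zero_at \<sigma> [] \<^bold>\<and> (\<^bold>\<forall>n. S (subseq \<sigma> n))))"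

definition Stp :: "'h::complete_heyting_algebra seq \<Rightarrow> 'h" where
  "Stp = lfp stump_step"

definition admits :: "'h::complete_heyting_algebra seq \<Rightarrow> nat list \<Rightarrow> 'h" where
  "admits \<sigma> s = (\<^bold>\<forall>i. tv (i \<le> length s) \<^bold>\<longrightarrow> zero_at \<sigma> (take i s))"

text \<open>
  The Thesis for decidable bars \<open>{s. \<beta>(s) \<noteq> 0}\<close>: some stump admits, along every \<open>\<gamma>\<close>, an initial
  part of \<open>\<gamma>\<close> that lies in the bar.
\<close>

definition brouwer_thesis :: "'h::complete_heyting_algebra" where
  "brouwer_thesis =
    (\<^bold>\<forall>\<N> \<beta>. (\<^bold>\<forall>\<N> \<gamma>. \<^bold>\<exists>n s. init \<gamma> n s \<^bold>\<and> nonzero_at \<beta> s) \<^bold>\<longrightarrow>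
      (\<^bold>\<exists>\<N> \<sigma>. Stp \<sigma> \<^bold>\<and> (\<^bold>\<forall>\<N> \<gamma>. \<^bold>\<exists>n s. init \<gamma> n s \<^bold>\<and> nonzero_at \<beta> s \<^bold>\<and> admits \<sigma> s)))"

section \<open>Almost-enumerable sets and perhapsive extensions\<close>

definition agree_upto :: "'h::complete_heyting_algebra seq \<Rightarrow> 'h seq \<Rightarrow> 'h seq \<Rightarrow> nat \<Rightarrow> 'h" where
  "agree_upto \<delta> \<alpha> \<gamma> n = (\<^bold>\<exists>k. \<gamma> n k \<^bold>\<and> same_init \<alpha> (subseq \<delta> n) k)"

text \<open>\<open>Almost \<delta>\<close> is the set \<open>Almost\<^sup>* (En \<delta>)\<close>, which depends on the enumeration \<open>\<delta>\<close>.\<close>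

definition Almost :: "'h::complete_heyting_algebra seq \<Rightarrow> 'h seq \<Rightarrow> 'h" where
  "Almost \<delta> \<alpha> = (\<^bold>\<forall>\<N> \<gamma>. \<^bold>\<exists>n. agree_upto \<delta> \<alpha> \<gamma> n)"

definition secures :: "'h::complete_heyting_algebra seq \<Rightarrow> 'h seq \<Rightarrow> 'h seq \<Rightarrow> 'h" where
  "secures \<sigma> \<delta> \<alpha> =
    (\<^bold>\<forall>\<N> \<gamma>. \<^bold>\<exists>n. (\<^bold>\<exists>s. init \<gamma> (n + 1) s \<^bold>\<and> admits \<sigma> s) \<^bold>\<and> agree_upto \<delta> \<alpha> \<gamma> n)"

definition perhaps_step ::
  "('h::complete_heyting_algebra seq \<Rightarrow> 'h) \<Rightarrow> ('h seq \<Rightarrow> 'h seq \<Rightarrow> 'h) \<Rightarrow> 'h seq \<Rightarrow> 'h seq \<Rightarrow> 'h"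
  where
  "perhaps_step X P \<sigma> \<alpha> =
    ((nonzero_at \<sigma> [] \<^bold>\<and> X \<alpha>) \<^bold>\<or>
     (zero_at \<sigma> [] \<^bold>\<and> (\<^bold>\<exists>\<N> \<beta>. X \<beta> \<^bold>\<and> (apart \<alpha> \<beta> \<^bold>\<longrightarrow> (\<^bold>\<exists>m. P (subseq \<sigma> m) \<alpha>)))))"

text \<open>
  Recursion on stumps: on \<open>Stp\<close> the recursion equation has exactly one solution (see
  \<open>perhaps_unfold\<close> and \<open>perhaps_unique\<close> below), so taking the least fixed point is only a
  device for defining it as a total function.
\<close>

definition perhaps ::
  "'h::complete_heyting_algebra seq \<Rightarrow> ('h seq \<Rightarrow> 'h) \<Rightarrow> 'h seq \<Rightarrow> 'h" where
  "perhaps \<sigma> X \<alpha> = lfp (perhaps_step X) \<sigma> \<alpha>"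

definition spread_law :: "'h::complete_heyting_algebra seq \<Rightarrow> 'h" where
  "spread_law \<beta> = (\<^bold>\<forall>s. zero_at \<beta> s \<^bold>\<longleftrightarrow> (\<^bold>\<exists>n. zero_at \<beta> (s @ [n])))"

definition PCS :: "'h::complete_heyting_algebra seq \<Rightarrow> 'h seq \<Rightarrow> 'h" where
  "PCS \<sigma> \<beta> = (spread_law \<beta> \<^bold>\<and> (\<^bold>\<exists>\<N> \<delta>. \<^bold>\<forall>\<N> \<alpha>. F_set \<beta> \<alpha> \<^bold>\<longrightarrow> perhaps \<sigma> (En \<delta>) \<alpha>))"

definition ACS :: "'h::complete_heyting_algebra seq \<Rightarrow> 'h" where
  "ACS \<beta> = (spread_law \<beta> \<^bold>\<and> (\<^bold>\<exists>\<N> \<delta>. \<^bold>\<forall>\<N> \<alpha>. F_set \<beta> \<alpha> \<^bold>\<longrightarrow> Almost \<delta> \<alpha>))"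

section \<open>The inductive definitions have their intended internal meaning\<close>

lemma hall_mono: "(\<And>x. \<phi> x \<le> \<psi> x) \<Longrightarrow> (\<^bold>\<forall>x. \<phi> x) \<le> (\<^bold>\<forall>x. \<psi> x)"
  unfolding hall_def by (rule INF_mono) auto

lemma hex_mono: "(\<And>x. \<phi> x \<le> \<psi> x) \<Longrightarrow> (\<^bold>\<exists>x. \<phi> x) \<le> (\<^bold>\<exists>x. \<psi> x)"
  unfolding hex_def by (rule SUP_mono) auto

lemma himp_mono: "q \<le> q' \<Longrightarrow> (p \<^bold>\<longrightarrow> q) \<le> (p \<^bold>\<longrightarrow> q')"
  by (meson le_himp_iff order.trans order_refl)

lemma mono_stump_step: "mono stump_step"
  unfolding mono_def le_fun_def stump_step_def
  by (intro allI impI sup_mono inf_mono hall_mono order_refl) blast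

lemma mono_perhaps_step: "mono (perhaps_step X)"
  unfolding mono_def le_fun_def perhaps_step_def sex_def
  by (intro allI impI sup_mono inf_mono hex_mono himp_mono order_refl) blast

lemma Stp_unfold: "Stp \<sigma> = (nonzero_at \<sigma> [] \<^bold>\<or> (zero_at \<sigma> [] \<^bold>\<and> (\<^bold>\<forall>n. Stp (subseq \<sigma> n))))"
  using lfp_unfold[OF mono_stump_step] by (metis Stp_def stump_step_def)

lemma perhaps_unfold:
  "perhaps \<sigma> X \<alpha> =
    ((nonzero_at \<sigma> [] \<^bold>\<and> X \<alpha>) \<^bold>\<or>
     (zero_at \<sigma> [] \<^bold>\<and>
       (\<^bold>\<exists>\<N> \<beta>. X \<beta> \<^bold>\<and> (apart \<alpha> \<beta> \<^bold>\<longrightarrow> (\<^bold>\<exists>m. perhaps (subseq \<sigma> m) X \<alpha>)))))"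
proof -
  have "perhaps \<sigma> X \<alpha> = perhaps_step X (lfp (perhaps_step X)) \<sigma> \<alpha>"
    using lfp_unfold[OF mono_perhaps_step, of X] by (metis perhaps_def)
  then show ?thesis
    by (simp add: perhaps_step_def perhaps_def)
qed

lemma le_hall_iff: "r \<le> (\<^bold>\<forall>x. \<phi> x) \<longleftrightarrow> (\<forall>x. r \<le> \<phi> x)"
  unfolding hall_def by (simp add: le_INF_iff)

lemma hall_le: "(\<^bold>\<forall>x. \<phi> x) \<le> \<phi> x"
  unfolding hall_def by (rule INF_lower) simp

lemma le_hex: "r \<le> \<phi> x \<Longrightarrow> r \<le> (\<^bold>\<exists>x. \<phi> x)"
  unfolding hex_def by (rule SUP_upper2) auto

lemma hex_le: "(\<And>x. \<phi> x \<le> q) \<Longrightarrow> (\<^bold>\<exists>x. \<phi> x) \<le> q"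
  unfolding hex_def by (rule SUP_least)

lemma inf_hex_le: "(\<And>x. inf r (\<phi> x) \<le> q) \<Longrightarrow> inf r (\<^bold>\<exists>x. \<phi> x) \<le> q"
  by (metis hex_le inf.commute le_himp_iff)

lemma inf_hdisj_le: "inf r p \<le> t \<Longrightarrow> inf r q \<le> t \<Longrightarrow> inf r (p \<^bold>\<or> q) \<le> t"
  by (metis inf.commute le_himp_iff sup_least)

lemma himp_mp: "r \<le> (p \<^bold>\<longrightarrow> q) \<Longrightarrow> r \<le> p \<Longrightarrow> r \<le> q"
  by (metis inf.absorb1 le_himp_iff)

lemma baire_subseq: "baire \<alpha> \<le> baire (subseq \<alpha> m)"
proof -
  have "baire \<alpha> \<le> (\<^bold>\<forall>n. \<^bold>\<exists>k. subseq \<alpha> m n k)"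
  proof -
    have "baire \<alpha> \<le> (\<^bold>\<forall>n. \<^bold>\<exists>m. \<alpha> n m)"
      unfolding baire_def by simp
    then show ?thesis
      unfolding subseq_def le_hall_iff by blast
  qed
  moreover have "baire \<alpha> \<le> (\<^bold>\<forall>n k k'. subseq \<alpha> m n k \<^bold>\<and> subseq \<alpha> m n k' \<^bold>\<longrightarrow> tv (k = k'))"
  proof -
    have "baire \<alpha> \<le> (\<^bold>\<forall>n m m'. \<alpha> n m \<^bold>\<and> \<alpha> n m' \<^bold>\<longrightarrow> tv (m = m'))"
      unfolding baire_def by simp
    then show ?thesis
      unfolding subseq_def le_hall_iff by blast
  qed
  ultimately show ?thesis
    unfolding baire_def[of "subseq \<alpha> m"] by simp
qed

lemma baire_zero_nonzero: "inf (baire \<sigma>) (inf (zero_at \<sigma> s) (nonzero_at \<sigma> s)) \<le> bot"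
proof -
  have "inf (inf (baire \<sigma>) (zero_at \<sigma> s)) (tv (m \<noteq> 0) \<^bold>\<and> \<sigma> (list_encode s) m) \<le> bot" for m
  proof (cases "m = 0")
    case False
    have "baire \<sigma> \<le> (\<sigma> (list_encode s) 0 \<^bold>\<and> \<sigma> (list_encode s) m \<^bold>\<longrightarrow> tv (0 = m))"
      unfolding baire_def by (meson hall_le inf.coboundedI2 order.trans)
    then have "inf (baire \<sigma>) (\<sigma> (list_encode s) 0 \<^bold>\<and> \<sigma> (list_encode s) m) \<le> bot"
      using False by (simp add: le_himp_iff tv_def)
    then show ?thesis
      using False by (simp add: zero_at_def tv_def inf.assoc)
  qed (simp add: tv_def)
  then have "inf (inf (baire \<sigma>) (zero_at \<sigma> s)) (nonzero_at \<sigma> s) \<le> bot"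
    unfolding nonzero_at_def by (rule inf_hex_le)
  then show ?thesis by (simp add: inf.assoc)
qed

lemma Stp_induct:
  assumes step: "p \<le> (\<^bold>\<forall>\<N> \<sigma>. stump_step A \<sigma> \<^bold>\<longrightarrow> A \<sigma>)"
  shows "p \<le> (\<^bold>\<forall>\<N> \<sigma>. Stp \<sigma> \<^bold>\<longrightarrow> A \<sigma>)"
proof -
  define Q where "Q = (\<lambda>\<sigma>. inf p (baire \<sigma>) \<^bold>\<longrightarrow> A \<sigma>)"
  have "stump_step Q \<sigma> \<le> Q \<sigma>" for \<sigma>
  proof -
    let ?r = "inf p (baire \<sigma>)"
    have "inf ?r (zero_at \<sigma> [] \<^bold>\<and> (\<^bold>\<forall>n. Q (subseq \<sigma> n))) \<le> A (subseq \<sigma> n)" (is "?l \<le> _") for n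
    proof (rule himp_mp)
      show "?l \<le> (inf p (baire (subseq \<sigma> n)) \<^bold>\<longrightarrow> A (subseq \<sigma> n))"
        using hall_le[of "\<lambda>n. Q (subseq \<sigma> n)" n] unfolding Q_def by (simp add: le_infI2)
      show "?l \<le> inf p (baire (subseq \<sigma> n))"
        using baire_subseq[of \<sigma> n] by (simp add: le_infI1 le_infI2)
    qed
    then have "inf ?r (zero_at \<sigma> [] \<^bold>\<and> (\<^bold>\<forall>n. Q (subseq \<sigma> n)))
        \<le> (zero_at \<sigma> [] \<^bold>\<and> (\<^bold>\<forall>n. A (subseq \<sigma> n)))"
      by (simp add: le_hall_iff le_infI2)
    then have "inf ?r (stump_step Q \<sigma>) \<le> stump_step A \<sigma>"
      unfolding stump_step_def by (intro inf_hdisj_le) (simp_all add: le_infI2 le_supI1 le_supI2)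
    moreover have "?r \<le> (stump_step A \<sigma> \<^bold>\<longrightarrow> A \<sigma>)"
      using step unfolding sall_def le_hall_iff le_himp_iff by blast
    ultimately have "inf ?r (stump_step Q \<sigma>) \<le> A \<sigma>"
      by (metis himp_mp inf.coboundedI1)
    then show ?thesis
      by (simp add: Q_def le_himp_iff inf.commute)
  qed
  then have "Stp \<le> Q"
    unfolding Stp_def by (intro lfp_lowerbound le_funI)
  then have "Stp \<sigma> \<le> (inf p (baire \<sigma>) \<^bold>\<longrightarrow> A \<sigma>)" for \<sigma>
    unfolding Q_def le_fun_def by blast
  then show ?thesis
    unfolding sall_def le_hall_iff le_himp_iff by (simp add: inf.commute)
qed

lemma perhaps_unique_aux:
  assumes Q: "\<And>\<sigma> \<alpha>. Q \<sigma> \<alpha> = perhaps_step X Q \<sigma> \<alpha>"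
    and R: "\<And>\<sigma> \<alpha>. R \<sigma> \<alpha> = perhaps_step X R \<sigma> \<alpha>"
  shows "inf (baire \<sigma>) (Stp \<sigma>) \<le> (Q \<sigma> \<alpha> \<^bold>\<longrightarrow> R \<sigma> \<alpha>)"
proof -
  define A where "A = (\<lambda>\<sigma>. \<^bold>\<forall>\<alpha>. Q \<sigma> \<alpha> \<^bold>\<longrightarrow> R \<sigma> \<alpha>)"
  have "inf (inf (baire \<sigma>) (stump_step A \<sigma>)) (Q \<sigma> \<alpha>) \<le> R \<sigma> \<alpha>" for \<sigma> \<alpha>
  proof -
    let ?z = "zero_at \<sigma> []" and ?nz = "nonzero_at \<sigma> []" and ?b = "baire \<sigma>"
    let ?all = "\<^bold>\<forall>n. A (subseq \<sigma> n)"
    let ?body = "\<lambda>P \<beta>. apart \<alpha> \<beta> \<^bold>\<longrightarrow> (\<^bold>\<exists>m. P (subseq \<sigma> m) \<alpha>)"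
    let ?ex = "\<lambda>P. \<^bold>\<exists>\<N> \<beta>. X \<beta> \<^bold>\<and> ?body P \<beta>"
    have body: "inf ?all (?body Q \<beta>) \<le> ?body R \<beta>" for \<beta>
    proof -
      have "inf ?all (Q (subseq \<sigma> m) \<alpha>) \<le> R (subseq \<sigma> m) \<alpha>" for m
      proof -
        have "?all \<le> (Q (subseq \<sigma> m) \<alpha> \<^bold>\<longrightarrow> R (subseq \<sigma> m) \<alpha>)"
          using hall_le[of "\<lambda>n. A (subseq \<sigma> n)" m]
          unfolding A_def le_hall_iff by blast
        then show ?thesis by (simp add: le_himp_iff)
      qed
      then have 1: "inf ?all (\<^bold>\<exists>m. Q (subseq \<sigma> m) \<alpha>) \<le> (\<^bold>\<exists>m. R (subseq \<sigma> m) \<alpha>)"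
        by (intro inf_hex_le le_hex)
      have "inf (?body Q \<beta>) (apart \<alpha> \<beta>) \<le> (\<^bold>\<exists>m. Q (subseq \<sigma> m) \<alpha>)"
        using le_himp_iff by blast
      then have "inf (inf ?all (?body Q \<beta>)) (apart \<alpha> \<beta>) \<le> inf ?all (\<^bold>\<exists>m. Q (subseq \<sigma> m) \<alpha>)"
        by (simp add: inf.assoc le_infI2)
      with 1 show ?thesis
        unfolding le_himp_iff by (rule order.trans[rotated])
    qed
    have ex: "inf ?all (?ex Q) \<le> ?ex R"
    proof -
      have "inf ?all (baire \<beta> \<^bold>\<and> X \<beta> \<^bold>\<and> ?body Q \<beta>) \<le> (baire \<beta> \<^bold>\<and> X \<beta> \<^bold>\<and> ?body R \<beta>)" for \<beta>
        by (intro inf_greatest order.trans[OF _ body[of \<beta>]])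
           (simp_all add: le_infI1 le_infI2)
      then show ?thesis
        unfolding sex_def by (intro inf_hex_le le_hex)
    qed
    have zz: "inf (inf ?b (?z \<^bold>\<and> ?all)) (?z \<^bold>\<and> ?ex Q) \<le> R \<sigma> \<alpha>"
    proof -
      have "inf (inf ?b (?z \<^bold>\<and> ?all)) (?z \<^bold>\<and> ?ex Q) \<le> (?z \<^bold>\<and> ?ex R)"
        by (intro inf_greatest order.trans[OF _ ex]) (simp_all add: le_infI1 le_infI2)
      then show ?thesis
        unfolding R[of \<sigma> \<alpha>] perhaps_step_def by (rule le_supI2)
    qed
    have nz: "inf (inf ?b ?nz) (?z \<^bold>\<and> ?ex Q) \<le> R \<sigma> \<alpha>"
    proof -
      have "inf (inf ?b ?nz) (?z \<^bold>\<and> ?ex Q) \<le> inf ?b (inf ?z ?nz)"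
        by (simp add: le_infI1 le_infI2)
      also have "\<dots> \<le> bot" by (rule baire_zero_nonzero)
      finally show ?thesis by (meson bot_least order.trans)
    qed
    have "inf (inf ?b (?z \<^bold>\<and> ?ex Q)) (stump_step A \<sigma>) \<le> R \<sigma> \<alpha>"
      unfolding stump_step_def
    proof (rule inf_hdisj_le)
      show "inf (inf ?b (?z \<^bold>\<and> ?ex Q)) ?nz \<le> R \<sigma> \<alpha>"
        using nz by (simp only: inf.assoc inf.commute inf.left_commute)
      show "inf (inf ?b (?z \<^bold>\<and> ?ex Q)) (?z \<^bold>\<and> ?all) \<le> R \<sigma> \<alpha>"
        using zz by (simp only: inf.assoc inf.commute inf.left_commute)
    qed
    then have 2: "inf (inf ?b (stump_step A \<sigma>)) (?z \<^bold>\<and> ?ex Q) \<le> R \<sigma> \<alpha>"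
      by (simp only: inf.assoc inf.commute inf.left_commute)
    have 3: "inf (inf ?b (stump_step A \<sigma>)) (?nz \<^bold>\<and> X \<alpha>) \<le> R \<sigma> \<alpha>"
      unfolding R[of \<sigma> \<alpha>] perhaps_step_def by (simp add: le_infI2 le_supI1)
    show ?thesis
      unfolding Q[of \<sigma> \<alpha>] perhaps_step_def using 3 2 by (rule inf_hdisj_le)
  qed
  then have "top \<le> (\<^bold>\<forall>\<N> \<sigma>. stump_step A \<sigma> \<^bold>\<longrightarrow> A \<sigma>)"
    unfolding sall_def le_hall_iff A_def le_himp_iff by (simp add: inf.assoc)
  from Stp_induct[OF this] have "inf (baire \<sigma>) (Stp \<sigma>) \<le> A \<sigma>"
    unfolding sall_def le_hall_iff le_himp_iff by simp
  then show ?thesis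
    unfolding A_def le_hall_iff by blast
qed

lemma perhaps_unique:
  assumes Q: "\<And>\<sigma> \<alpha>. Q \<sigma> \<alpha> = perhaps_step X Q \<sigma> \<alpha>"
  shows "valid (\<^bold>\<forall>\<N> \<sigma>. Stp \<sigma> \<^bold>\<longrightarrow> (\<^bold>\<forall>\<N> \<alpha>. Q \<sigma> \<alpha> \<^bold>\<longleftrightarrow> perhaps \<sigma> X \<alpha>))"
proof -
  have R: "perhaps \<sigma> X \<alpha> = perhaps_step X (\<lambda>\<sigma>. perhaps \<sigma> X) \<sigma> \<alpha>" for \<sigma> \<alpha>
    unfolding perhaps_step_def by (rule perhaps_unfold)
  have "inf (baire \<sigma>) (Stp \<sigma>) \<le> (Q \<sigma> \<alpha> \<^bold>\<longleftrightarrow> perhaps \<sigma> X \<alpha>)" for \<sigma> \<alpha>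
    using perhaps_unique_aux[of Q X "\<lambda>\<sigma>. perhaps \<sigma> X", OF Q R]
      perhaps_unique_aux[of "\<lambda>\<sigma>. perhaps \<sigma> X" X Q, OF R Q]
    unfolding hiff_def by simp
  then have "top \<le> (\<^bold>\<forall>\<N> \<sigma>. Stp \<sigma> \<^bold>\<longrightarrow> (\<^bold>\<forall>\<N> \<alpha>. Q \<sigma> \<alpha> \<^bold>\<longleftrightarrow> perhaps \<sigma> X \<alpha>))"
    unfolding sall_def le_hall_iff le_himp_iff by (simp add: le_infI1)
  then show ?thesis
    unfolding valid_def by (simp add: top.extremum_unique)
qed

end

theory Submission
  imports Defs
begin

text \<open>
  All propositions are proved by Kripke--Joyal forcing: a fact \<open>\<phi>\<close> is derived as \<open>p \<le> \<phi>\<close> for an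
  arbitrary stage \<open>p\<close>, and existentials and disjunctions are eliminated by passing to smaller stages.

  If a stump \<open>\<sigma>\<close> secures \<open>\<alpha>\<close>, take \<open>\<delta>\<^sup>0\<close> as the witness for \<open>\<alpha> \<in> \<P>(\<sigma>, En \<delta>)\<close>: if \<open>\<alpha>\<close> differs from
  \<open>\<delta>\<^sup>0\<close> before \<open>k\<close>, then no \<open>\<gamma>\<close> starting with \<open>k\<close> can succeed at place 0, so \<open>\<sigma>\<^sup>k\<close> secures the same for
  the remaining \<open>\<delta>\<^sup>1, \<delta>\<^sup>2, \<dots>\<close>, and one concludes by induction on stumps. Brouwer's Thesis, applied to
  the decidable bar of those finite sequences at whose last place agreement occurs, produces a
  securing stump.

  For a spread \<open>F\<^sub>\<beta>\<close> the Thesis is applied to sequences of pairs, coding \<open>\<alpha>\<close> and \<open>\<gamma>\<close> together, and to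
  the bar ``\<open>\<alpha>\<close> has left the spread, or agreement has occurred''. It is a bar because Baire space
  retracts onto the spread. The resulting stump works for every \<open>\<alpha> \<in> F\<^sub>\<beta>\<close> at once: the stump induction
  only needs some immediate substump, which may be chosen depending on \<open>\<alpha>\<close>. Neither the fan theorem
  nor a choice principle is involved.
\<close>

section \<open>Kripke--Joyal reasoning\<close>

lemma himpI: "(\<And>q. q \<le> p \<Longrightarrow> q \<le> a \<Longrightarrow> q \<le> b) \<Longrightarrow> p \<le> (a \<^bold>\<longrightarrow> b)"
  by (simp add: le_himp_iff)

lemma hallI: "(\<And>x. p \<le> \<phi> x) \<Longrightarrow> p \<le> (\<^bold>\<forall>x. \<phi> x)"
  by (simp add: le_hall_iff)

lemma hallD: "p \<le> (\<^bold>\<forall>x. \<phi> x) \<Longrightarrow> p \<le> \<phi> x"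
  by (simp add: le_hall_iff)

lemma hconjD1: "p \<le> (a \<^bold>\<and> b) \<Longrightarrow> p \<le> a"
  and hconjD2: "p \<le> (a \<^bold>\<and> b) \<Longrightarrow> p \<le> b"
  by simp_all

text \<open>Binary meets distribute over suprema, so a stage below an existential is covered by the
  smaller stages \<open>inf p (\<phi> x)\<close>. It is enough to derive the goal at each of these,
  with an actual witness \<open>x\<close> in hand.\<close>

lemma hexE:
  assumes "p \<le> (\<^bold>\<exists>x. \<phi> x)" and "\<And>x q. q \<le> p \<Longrightarrow> q \<le> \<phi> x \<Longrightarrow> q \<le> \<psi>"
  shows "p \<le> \<psi>"
proof -
  have "inf p (\<^bold>\<exists>x. \<phi> x) \<le> \<psi>"
    by (rule inf_hex_le) (metis assms(2) inf.cobounded1 inf.cobounded2)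
  then show ?thesis using assms(1) by (simp add: inf.absorb1)
qed

text \<open>Frame distributivity as an equation. Together with its mirror image it moves
  existentials to the front of a conjunction, where \<open>hexE\<close> can remove them one after
  another.\<close>

lemma inf_hex_distrib: "(a \<^bold>\<and> (\<^bold>\<exists>x. \<phi> x)) = (\<^bold>\<exists>x. a \<^bold>\<and> \<phi> x)"
proof (rule order.antisym)
  show "(a \<^bold>\<and> (\<^bold>\<exists>x. \<phi> x)) \<le> (\<^bold>\<exists>x. a \<^bold>\<and> \<phi> x)"
    by (rule inf_hex_le) (rule le_hex[OF order_refl])
  show "(\<^bold>\<exists>x. a \<^bold>\<and> \<phi> x) \<le> (a \<^bold>\<and> (\<^bold>\<exists>x. \<phi> x))"
    by (rule hex_le) (meson inf_mono le_hex order_refl)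
qed

lemma hex_inf_distrib: "((\<^bold>\<exists>x. \<phi> x) \<^bold>\<and> a) = (\<^bold>\<exists>x. \<phi> x \<^bold>\<and> a)"
  using inf_hex_distrib[of a \<phi>] by (simp add: inf.commute)

lemma hdisjE:
  assumes "p \<le> (a \<^bold>\<or> b)"
    and "\<And>q. q \<le> p \<Longrightarrow> q \<le> a \<Longrightarrow> q \<le> \<psi>" and "\<And>q. q \<le> p \<Longrightarrow> q \<le> b \<Longrightarrow> q \<le> \<psi>"
  shows "p \<le> \<psi>"
proof -
  have "inf p (a \<^bold>\<or> b) \<le> \<psi>"
    by (rule inf_hdisj_le; rule assms; simp)
  then show ?thesis using assms(1) by (simp add: inf.absorb1)
qed

lemma botE: "p \<le> (bot :: 'h::complete_heyting_algebra) \<Longrightarrow> p \<le> \<psi>"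
  by (rule order.trans[OF _ bot_least])

lemma tvI: "b \<Longrightarrow> p \<le> tv b"
  by (simp add: tv_def)

text \<open>If \<open>b\<close> fails, then \<open>tv b\<close> is \<open>bot\<close> and the stage
  forces everything. Hence a condition on standard numbers may simply be assumed in the
  metalogic.\<close>

lemma tvE: "p \<le> tv b \<Longrightarrow> (b \<Longrightarrow> p \<le> \<psi>) \<Longrightarrow> p \<le> \<psi>"
  by (cases b) (simp_all add: tv_def botE)

lemma tv_himpI: "(b \<Longrightarrow> p \<le> q) \<Longrightarrow> p \<le> (tv b \<^bold>\<longrightarrow> q)"
  by (cases b) (auto simp: tv_def le_himp_iff)

lemma tv_himpD: "p \<le> (tv b \<^bold>\<longrightarrow> q) \<Longrightarrow> b \<Longrightarrow> p \<le> q"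
  by (simp add: tv_def le_himp_iff)

lemma sallI: "(\<And>\<alpha> q. q \<le> p \<Longrightarrow> q \<le> baire \<alpha> \<Longrightarrow> q \<le> \<phi> \<alpha>) \<Longrightarrow> p \<le> (\<^bold>\<forall>\<N> \<alpha>. \<phi> \<alpha>)"
  unfolding sall_def by (intro hallI himpI) blast

lemma sallD: "p \<le> (\<^bold>\<forall>\<N> \<alpha>. \<phi> \<alpha>) \<Longrightarrow> p \<le> baire \<alpha> \<Longrightarrow> p \<le> \<phi> \<alpha>"
  unfolding sall_def by (drule hallD) (rule himp_mp)

lemma sexI: "p \<le> baire \<alpha> \<Longrightarrow> p \<le> \<phi> \<alpha> \<Longrightarrow> p \<le> (\<^bold>\<exists>\<N> \<alpha>. \<phi> \<alpha>)"
  unfolding sex_def by (rule le_hex[where x = \<alpha>]) simp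

lemma sexE:
  assumes "p \<le> (\<^bold>\<exists>\<N> \<alpha>. \<phi> \<alpha>)"
    and "\<And>\<alpha> q. q \<le> p \<Longrightarrow> q \<le> baire \<alpha> \<Longrightarrow> q \<le> \<phi> \<alpha> \<Longrightarrow> q \<le> \<psi>"
  shows "p \<le> \<psi>"
  using assms(1) unfolding sex_def by (rule hexE) (metis assms(2) le_inf_iff)

lemma validI: "(\<And>p. p \<le> \<phi>) \<Longrightarrow> valid \<phi>"
  unfolding valid_def by (meson top.extremum_unique)

lemma validD: "valid \<phi> \<Longrightarrow> p \<le> \<phi>"
  unfolding valid_def by simp

section \<open>Sequences and their initial parts\<close>

lemma baireI:
  assumes "\<And>n. p \<le> (\<^bold>\<exists>m. \<alpha> n m)"
    and "\<And>n m m' q. q \<le> p \<Longrightarrow> q \<le> \<alpha> n m \<Longrightarrow> q \<le> \<alpha> n m' \<Longrightarrow> m \<noteq> m' \<Longrightarrow> q \<le> bot"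
  shows "p \<le> baire \<alpha>"
proof -
  have "q \<le> tv (m = m')" if "q \<le> p" "q \<le> (\<alpha> n m \<^bold>\<and> \<alpha> n m')" for q n m m'
    using assms(2)[OF that(1), of n m m'] that(2) by (cases "m = m'") (auto simp: tv_def)
  then show ?thesis
    unfolding baire_def by (intro inf_greatest hallI himpI assms(1)) blast
qed

lemma baire_total: "p \<le> baire \<alpha> \<Longrightarrow> p \<le> (\<^bold>\<exists>m. \<alpha> n m)"
  unfolding baire_def by (drule hconjD1) (rule hallD)

text \<open>Two values at the same place are standard numbers: either they are equal outright, or
  the stage is \<open>bot\<close>. The continuation form makes the metalogical equality available to
  whatever goal is being proved.\<close>

lemma baire_single:
  assumes "p \<le> baire \<alpha>" "p \<le> \<alpha> n m" "p \<le> \<alpha> n m'"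
  shows "(m = m' \<Longrightarrow> p \<le> \<psi>) \<Longrightarrow> p \<le> \<psi>"
proof -
  have "p \<le> (\<alpha> n m \<^bold>\<and> \<alpha> n m' \<^bold>\<longrightarrow> tv (m = m'))"
    using assms(1) unfolding baire_def le_inf_iff le_hall_iff by blast
  then have "p \<le> tv (m = m')"
    by (rule himp_mp) (simp add: assms)
  then show "(m = m' \<Longrightarrow> p \<le> \<psi>) \<Longrightarrow> p \<le> \<psi>" by (rule tvE)
qed

lemma le_baire_subseq: "p \<le> baire \<alpha> \<Longrightarrow> p \<le> baire (subseq \<alpha> m)"
  using baire_subseq order.trans by blast

text \<open>Below \<open>p\<close> the value of \<open>\<beta>\<close> at \<open>s\<close> is a
  standard number, and for such a number being 0 is decided in the metalogic.\<close>

lemma zero_nonzero_cases: "p \<le> baire \<beta> \<Longrightarrow> p \<le> (zero_at \<beta> s \<^bold>\<or> nonzero_at \<beta> s)"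
proof (erule hexE[OF baire_total[where n = "list_encode s"]])
  fix m q assume "q \<le> p" "q \<le> \<beta> (list_encode s) m"
  then show "q \<le> (zero_at \<beta> s \<^bold>\<or> nonzero_at \<beta> s)"
    unfolding zero_at_def nonzero_at_def
    by (cases "m = 0") (simp add: le_supI1, intro le_supI2 le_hex[where x = m], simp add: tvI)
qed

lemma zero_nonzero_absurd:
  "p \<le> baire \<beta> \<Longrightarrow> p \<le> zero_at \<beta> s \<Longrightarrow> p \<le> nonzero_at \<beta> s \<Longrightarrow> p \<le> \<psi>"
  by (rule botE, rule order.trans[OF _ baire_zero_nonzero[of \<beta> s]]) simp

section \<open>Initial parts as actual lists of numbers\<close>

lemma initI: "length s = n \<Longrightarrow> (\<And>i. i < n \<Longrightarrow> p \<le> \<alpha> i (s ! i)) \<Longrightarrow> p \<le> init \<alpha> n s"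
  unfolding init_def by (simp add: tvI hallI tv_himpI)

lemma init_nth: "p \<le> init \<alpha> n s \<Longrightarrow> i < n \<Longrightarrow> p \<le> \<alpha> i (s ! i)"
  unfolding init_def by (drule hconjD2, drule hallD, erule tv_himpD)

lemma init_length: "p \<le> init \<alpha> n s \<Longrightarrow> (length s = n \<Longrightarrow> p \<le> \<psi>) \<Longrightarrow> p \<le> \<psi>"
  unfolding init_def by (drule hconjD1) (rule tvE)

lemma init_take:
  assumes "p \<le> init \<alpha> n s" "k \<le> n" shows "p \<le> init \<alpha> k (take k s)"
proof (rule init_length[OF assms(1)])
  assume "length s = n"
  then show ?thesis
    using assms(2) init_nth[OF assms(1)] by (intro initI) auto
qed

text \<open>Two different lists of equal length differ at a definite index, where single-valuedness
  of \<open>\<alpha>\<close> collapses the stage.\<close>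

lemma init_unique:
  assumes "p \<le> baire \<alpha>" "p \<le> init \<alpha> n s" "p \<le> init \<alpha> n t"
    and *: "s = t \<Longrightarrow> p \<le> \<psi>"
  shows "p \<le> \<psi>"
proof (rule init_length[OF assms(2)], rule init_length[OF assms(3)])
  assume l: "length s = n" "length t = n"
  show "p \<le> \<psi>"
  proof (cases "s = t")
    case False
    then obtain i where "i < n" "s ! i \<noteq> t ! i"
      using l nth_equalityI by metis
    then show ?thesis
      using baire_single[OF assms(1) init_nth[OF assms(2)] init_nth[OF assms(3)]] by blast
  qed (rule *)
qed

text \<open>Induction on the length: each further value of \<open>\<alpha>\<close> is found by
  passing to smaller stages, so that finitely many refinements yield an actual list.\<close>

lemma init_ex: "p \<le> baire \<alpha> \<Longrightarrow> p \<le> (\<^bold>\<exists>s. init \<alpha> n s)"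
proof (induction n arbitrary: p)
  case 0
  show ?case by (rule le_hex[where x = "[]"]) (simp add: initI)
next
  case (Suc n)
  show ?case
  proof (rule hexE[OF Suc.IH[OF Suc.prems]])
    fix s q assume qp: "q \<le> p" and s: "q \<le> init \<alpha> n s"
    show "q \<le> (\<^bold>\<exists>s. init \<alpha> (Suc n) s)"
    proof (rule hexE[OF baire_total[OF order.trans[OF qp Suc.prems], of n]], rule init_length)
      fix m r assume rq: "r \<le> q" and m: "r \<le> \<alpha> n m"
      show s: "r \<le> init \<alpha> n s" using rq s by (rule order.trans)
      assume l: "length s = n"
      show "r \<le> (\<^bold>\<exists>s. init \<alpha> (Suc n) s)"
        by (rule le_hex[where x = "s @ [m]"], rule initI)
           (use l m s in \<open>auto simp: nth_append less_Suc_eq dest: init_nth\<close>)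
    qed
  qed
qed

section \<open>Agreement up to a length, and apartness\<close>

lemma same_initI: "p \<le> init \<alpha> n s \<Longrightarrow> p \<le> init \<beta> n s \<Longrightarrow> p \<le> same_init \<alpha> \<beta> n"
  unfolding same_init_def by (rule le_hex[where x = s]) simp

lemma same_initE:
  assumes "p \<le> same_init \<alpha> \<beta> n"
    and "\<And>s q. q \<le> p \<Longrightarrow> q \<le> init \<alpha> n s \<Longrightarrow> q \<le> init \<beta> n s \<Longrightarrow> q \<le> \<psi>"
  shows "p \<le> \<psi>"
  using assms(1) unfolding same_init_def by (rule hexE) (metis assms(2) le_inf_iff)

lemma apartI: "p \<le> \<alpha> n m \<Longrightarrow> p \<le> \<beta> n m' \<Longrightarrow> m \<noteq> m' \<Longrightarrow> p \<le> apart \<alpha> \<beta>"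
  unfolding apart_def
  by (rule le_hex[where x = n], rule le_hex[where x = m], rule le_hex[where x = m'])
     (simp add: tvI)

lemma apartE:
  assumes "p \<le> apart \<alpha> \<beta>"
    and "\<And>n m m' q. q \<le> p \<Longrightarrow> q \<le> \<alpha> n m \<Longrightarrow> q \<le> \<beta> n m' \<Longrightarrow> m \<noteq> m' \<Longrightarrow> q \<le> \<psi>"
  shows "p \<le> \<psi>"
  using assms(1) unfolding apart_def
proof (elim hexE)
  fix n q1 m q2 m' q
  assume "q1 \<le> p" "q2 \<le> q1" "q \<le> q2" and *: "q \<le> (\<alpha> n m \<^bold>\<and> \<beta> n m' \<^bold>\<and> tv (m \<noteq> m'))"
  then have "q \<le> p" by simp
  show "q \<le> \<psi>"
    by (rule tvE[of q "m \<noteq> m'"]) (use * in simp, rule assms(2)[OF \<open>q \<le> p\<close>], use * in auto)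
qed

lemma init_diff_apart:
  assumes "p \<le> init \<alpha> n s" "p \<le> init \<beta> n t" "s \<noteq> t"
  shows "p \<le> apart \<alpha> \<beta>"
proof (rule init_length[OF assms(1)], rule init_length[OF assms(2)])
  assume "length s = n" "length t = n"
  then obtain i where "i < n" "s ! i \<noteq> t ! i"
    using \<open>s \<noteq> t\<close> nth_equalityI by metis
  then show ?thesis
    using init_nth[OF assms(1)] init_nth[OF assms(2)] by (intro apartI[of p \<alpha> i]) auto
qed

text \<open>After refinement the initial parts of length \<open>n\<close> are actual lists
  \<open>s\<close> and \<open>t\<close>, whose equality is decided in the metalogic. Equal lists
  give agreement; different lists give a place of apartness and exclude agreement.\<close>

lemma same_init_cases:
  assumes "p \<le> baire \<alpha>" "p \<le> baire \<beta>"
  shows "p \<le> (same_init \<alpha> \<beta> n \<^bold>\<or> (apart \<alpha> \<beta> \<^bold>\<and> (same_init \<alpha> \<beta> n \<^bold>\<longrightarrow> bot)))"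
proof (rule hexE[OF init_ex[OF assms(1), of n]])
  fix s q assume qp: "q \<le> p" and s: "q \<le> init \<alpha> n s"
  note b = assms[THEN order.trans[OF qp]]
  show "q \<le> (same_init \<alpha> \<beta> n \<^bold>\<or> (apart \<alpha> \<beta> \<^bold>\<and> (same_init \<alpha> \<beta> n \<^bold>\<longrightarrow> bot)))"
  proof (rule hexE[OF init_ex[OF b(2), of n]])
    fix t r assume rq: "r \<le> q" and t: "r \<le> init \<beta> n t"
    note b = b[THEN order.trans[OF rq]] and s = s[THEN order.trans[OF rq]]
    show "r \<le> (same_init \<alpha> \<beta> n \<^bold>\<or> (apart \<alpha> \<beta> \<^bold>\<and> (same_init \<alpha> \<beta> n \<^bold>\<longrightarrow> bot)))"
    proof (cases "s = t")
      case True
      then show ?thesis using s t by (intro le_supI1) (blast intro: same_initI)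
    next
      case False
      have "u \<le> bot" if ur: "u \<le> r" and "u \<le> same_init \<alpha> \<beta> n" for u
        using that(2)
      proof (rule same_initE)
        fix w v assume vu: "v \<le> u" and w: "v \<le> init \<alpha> n w" "v \<le> init \<beta> n w"
        have vr: "v \<le> r" using vu ur by (rule order.trans)
        note b = b[THEN order.trans[OF vr]]
          and s = s[THEN order.trans[OF vr]] and t = t[THEN order.trans[OF vr]]
        \<comment> \<open>A common initial part \<open>w\<close> would be equal to both
          \<open>s\<close> and \<open>t\<close>.\<close>
        show "v \<le> bot"
          by (rule init_unique[OF b(1) s w(1)], rule init_unique[OF b(2) t w(2)])
             (use False in simp)
      qed
      then show ?thesis
        using init_diff_apart[OF s t False]
        by (intro le_supI2 inf_greatest himpI)
    qed
  qed
qed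

section \<open>Securing implies membership in a perhapsive extension\<close>

text \<open>\<open>E i v c\<close> says that \<open>c\<close> is the label by which the stump registers the value \<open>v\<close> of \<open>\<gamma>\<close> at \<open>i\<close>,
  and \<open>g\<close> is the part of \<open>\<gamma>\<close> that has already been used up.\<close>

definition secured_along ::
  "(nat \<Rightarrow> nat \<Rightarrow> nat \<Rightarrow> 'h::complete_heyting_algebra) \<Rightarrow> 'h seq \<Rightarrow> 'h seq \<Rightarrow> 'h seq \<Rightarrow>
    nat list \<Rightarrow> 'h seq \<Rightarrow> 'h"
  where
  "secured_along E \<delta> \<alpha> \<sigma> g \<gamma> =
    (\<^bold>\<exists>w s. tv (length g \<le> length w \<and> length s = length w) \<^bold>\<and> init \<gamma> (length w) w \<^bold>\<and>
      (\<^bold>\<forall>j. tv (j < length w) \<^bold>\<longrightarrow> E j (w ! j) (s ! j)) \<^bold>\<and>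
      admits \<sigma> (drop (length g) s) \<^bold>\<and>
      (\<^bold>\<exists>j. tv (j < length w) \<^bold>\<and> same_init \<alpha> (subseq \<delta> j) (w ! j)))"

text \<open>The form of securing that survives a stump induction: \<open>\<sigma>\<close> is the
  substump reached after following the labels of the entries of \<open>g\<close>, and only those
  \<open>\<gamma>\<close> that continue \<open>g\<close> are still considered.\<close>

definition secured_from ::
  "(nat \<Rightarrow> nat \<Rightarrow> nat \<Rightarrow> 'h::complete_heyting_algebra) \<Rightarrow> 'h seq \<Rightarrow> 'h seq \<Rightarrow> 'h seq \<Rightarrow> nat list \<Rightarrow> 'h"
  where
  "secured_from E \<delta> \<alpha> \<sigma> g =
    (\<^bold>\<forall>\<N> \<gamma>. init \<gamma> (length g) g \<^bold>\<longrightarrow> secured_along E \<delta> \<alpha> \<sigma> g \<gamma>)"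

lemma admits_Nil: "p \<le> admits \<sigma> s \<Longrightarrow> p \<le> zero_at \<sigma> []"
  unfolding admits_def by (drule hallD[where x = 0], drule tv_himpD) simp_all

lemma admits_Cons: "p \<le> admits \<sigma> (c # s) \<Longrightarrow> p \<le> admits (subseq \<sigma> c) s"
  unfolding admits_def
proof (intro hallI tv_himpI)
  fix i assume "p \<le> (\<^bold>\<forall>i. tv (i \<le> length (c # s)) \<^bold>\<longrightarrow> zero_at \<sigma> (take i (c # s)))" "i \<le> length s"
  then have "p \<le> zero_at \<sigma> (take (Suc i) (c # s))"
    by (drule_tac hallD[where x = "Suc i"]) (erule tv_himpD, simp)
  then show "p \<le> zero_at (subseq \<sigma> c) (take i s)"
    by (simp add: zero_at_def subseq_def)
qed

lemma secured_fromE: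
  assumes "p \<le> secured_from E \<delta> \<alpha> \<sigma> g" "p \<le> baire \<gamma>" "p \<le> init \<gamma> (length g) g"
    and "\<And>w s j q. \<lbrakk>q \<le> p; length g \<le> length w; length s = length w; q \<le> init \<gamma> (length w) w;
          \<And>j. j < length w \<Longrightarrow> q \<le> E j (w ! j) (s ! j); q \<le> admits \<sigma> (drop (length g) s);
          j < length w; q \<le> same_init \<alpha> (subseq \<delta> j) (w ! j)\<rbrakk> \<Longrightarrow> q \<le> \<psi>"
  shows "p \<le> \<psi>"
proof -
  note himp_mp[OF sallD[OF assms(1)[unfolded secured_from_def secured_along_def] assms(2)] assms(3)]
  then show ?thesis
  proof (elim hexE)
    fix w q1 s q
    assume le: "q1 \<le> p" "q \<le> q1"
      and *: "q \<le> (tv (length g \<le> length w \<and> length s = length w) \<^bold>\<and> init \<gamma> (length w) w \<^bold>\<and>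
        (\<^bold>\<forall>j. tv (j < length w) \<^bold>\<longrightarrow> E j (w ! j) (s ! j)) \<^bold>\<and>
        admits \<sigma> (drop (length g) s) \<^bold>\<and>
        (\<^bold>\<exists>j. tv (j < length w) \<^bold>\<and> same_init \<alpha> (subseq \<delta> j) (w ! j)))"
    from * have 1: "q \<le> tv (length g \<le> length w \<and> length s = length w)"
      and 2: "q \<le> init \<gamma> (length w) w"
      and 3: "q \<le> (\<^bold>\<forall>j. tv (j < length w) \<^bold>\<longrightarrow> E j (w ! j) (s ! j))"
      and 4: "q \<le> admits \<sigma> (drop (length g) s)"
      and 5: "q \<le> (\<^bold>\<exists>j. tv (j < length w) \<^bold>\<and> same_init \<alpha> (subseq \<delta> j) (w ! j))"
      by simp_all
    show "q \<le> \<psi>"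
    proof (rule tvE[OF 1], rule hexE[OF 5])
      fix j r assume rq: "r \<le> q" and j: "r \<le> (tv (j < length w) \<^bold>\<and> same_init \<alpha> (subseq \<delta> j) (w ! j))"
        and l: "length g \<le> length w \<and> length s = length w"
      have rp: "r \<le> p" using rq le by simp
      show "r \<le> \<psi>"
      proof (rule tvE[OF hconjD1[OF j]], rule assms(4)[OF rp])
        show "r \<le> E j (w ! j) (s ! j)" if "j < length w" for j
          using order.trans[OF rq tv_himpD[OF hallD[OF 3] that]] .
      qed (use l 2 4 rq j in auto)
    qed
  qed
qed

lemma secured_fromI:
  assumes "\<And>\<gamma> q. q \<le> p \<Longrightarrow> q \<le> baire \<gamma> \<Longrightarrow> q \<le> init \<gamma> (length g) g \<Longrightarrow> q \<le> secured_along E \<delta> \<alpha> \<sigma> g \<gamma>"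
  shows "p \<le> secured_from E \<delta> \<alpha> \<sigma> g"
  unfolding secured_from_def
proof (intro sallI himpI)
  fix \<gamma> q r
  assume "q \<le> p" "q \<le> baire \<gamma>" "r \<le> q" "r \<le> init \<gamma> (length g) g"
  then show "r \<le> secured_along E \<delta> \<alpha> \<sigma> g \<gamma>"
    by (intro assms) auto
qed

lemma secured_alongI:
  assumes "length g \<le> length w" "length s = length w" "q \<le> init \<gamma> (length w) w"
    and "\<And>j. j < length w \<Longrightarrow> q \<le> E j (w ! j) (s ! j)" "q \<le> admits \<sigma> (drop (length g) s)"
    and "j < length w" "q \<le> same_init \<alpha> (subseq \<delta> j) (w ! j)"
  shows "q \<le> secured_along E \<delta> \<alpha> \<sigma> g \<gamma>"
  unfolding secured_along_def
  by (rule le_hex[where x = w], rule le_hex[where x = s])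
     (use assms in \<open>auto intro!: tvI hallI tv_himpI le_hex[where x = j]\<close>)

text \<open>A \<open>\<gamma>\<close> that continues \<open>g @ [k]\<close> also continues
  \<open>g\<close>, so a securing initial part \<open>w\<close> exists for it. Since agreement has
  failed on all of \<open>g\<close>, this \<open>w\<close> must contain the place
  \<open>length g\<close>. The label there is that of \<open>k\<close>, namely \<open>c\<close>, and
  admission by \<open>\<sigma>\<close> therefore passes to the substump at \<open>c\<close>.\<close>

lemma secured_from_extend:
  assumes sec: "p \<le> secured_from E \<delta> \<alpha> \<sigma> g"
    and fails: "\<And>j. j < length g \<Longrightarrow> p \<le> (same_init \<alpha> (subseq \<delta> j) (g ! j) \<^bold>\<longrightarrow> bot)"
    and single: "\<And>i v c c' q. q \<le> p \<Longrightarrow> q \<le> E i v c \<Longrightarrow> q \<le> E i v c' \<Longrightarrow> c \<noteq> c' \<Longrightarrow> q \<le> bot"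
    and c: "p \<le> E (length g) k c"
  shows "p \<le> secured_from E \<delta> \<alpha> (subseq \<sigma> c) (g @ [k])"
proof (rule secured_fromI)
  fix \<gamma> q assume qp: "q \<le> p" and b: "q \<le> baire \<gamma>" and ini: "q \<le> init \<gamma> (length (g @ [k])) (g @ [k])"
  note sec = sec[THEN order.trans[OF qp]] and fails = fails[THEN order.trans[OF qp]]
    and c = c[THEN order.trans[OF qp]]
  have g: "q \<le> init \<gamma> (length g) g"
    using init_take[OF ini, of "length g"] by simp
  show "q \<le> secured_along E \<delta> \<alpha> (subseq \<sigma> c) (g @ [k]) \<gamma>" (is "_ \<le> ?goal")
  proof (rule secured_fromE[OF sec b g])
    fix w s j r
    assume rq: "r \<le> q" and l: "length g \<le> length w" "length s = length w"
      and w: "r \<le> init \<gamma> (length w) w" and E: "\<And>j. j < length w \<Longrightarrow> r \<le> E j (w ! j) (s ! j)"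
      and ad: "r \<le> admits \<sigma> (drop (length g) s)"
      and j: "j < length w" "r \<le> same_init \<alpha> (subseq \<delta> j) (w ! j)"
    note b = b[THEN order.trans[OF rq]] and g = g[THEN order.trans[OF rq]]
      and ini = ini[THEN order.trans[OF rq]] and fails = fails[THEN order.trans[OF rq]]
      and c = c[THEN order.trans[OF rq]]
    have g': "r \<le> init \<gamma> (length g) (take (length g) w)"
      using w l(1) by (rule init_take)
    show "r \<le> ?goal"
    proof (rule init_unique[OF b g g'])
      assume gw: "g = take (length g) w"
      show "r \<le> ?goal"
      \<comment> \<open>If \<open>w\<close> is no longer than \<open>g\<close>, the agreement lies
        inside \<open>g\<close>, where it has been excluded.\<close>
      proof (cases "length w = length g")
        case True
        then have "w = g" using gw by simp
        then show ?thesis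
          using j himp_mp[OF fails[of j]] botE by auto
      next
        case False
        then have lt: "length g < length w" using l by simp
        have k: "r \<le> \<gamma> (length g) k"
          using init_nth[OF ini, of "length g"] by simp
        show ?thesis
        proof (rule baire_single[OF b k init_nth[OF w lt]])
          assume "k = w ! length g"
          show ?thesis
          \<comment> \<open>Both labels register the same value \<open>k\<close> at the same place,
            so \<open>single\<close> leaves only the case of equality.\<close>
          proof (cases "c = s ! length g")
            case True
            then have "drop (length g) s = c # drop (length (g @ [k])) s"
              using lt l by (simp add: Cons_nth_drop_Suc)
            then have "r \<le> admits (subseq \<sigma> c) (drop (length (g @ [k])) s)"
              using ad admits_Cons by metis
            then show ?thesis
              using lt l w E j by (intro secured_alongI) auto
          next
            case False
            then have "r \<le> bot"
              using c E[OF lt] single[OF order.trans[OF rq qp], of "length g" k c "s ! length g"]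
                \<open>k = w ! length g\<close> by simp
            then show ?thesis by (rule botE)
          qed
        qed
      qed
    qed
  qed
qed

section \<open>Stump induction for secured sequences\<close>

lemma seq_eq_refl: "p \<le> baire \<alpha> \<Longrightarrow> p \<le> seq_eq \<alpha> \<alpha>"
  unfolding seq_eq_def by (simp add: hallI baire_total)

text \<open>The argument runs for any total and single-valued registration \<open>E\<close> of
  values by labels, because the induction only has to name one substump to descend into. Taking the
  value itself as label treats a single \<open>\<alpha>\<close>; taking a pair of values as label
  will treat all members of a spread with one stump.\<close>

lemma secured_perhaps:
  assumes b: "p \<le> baire \<alpha>" "p \<le> baire \<delta>"
    and total: "\<And>i v. p \<le> (\<^bold>\<exists>c. E i v c)"
    and single: "\<And>i v c c' q. q \<le> p \<Longrightarrow> q \<le> E i v c \<Longrightarrow> q \<le> E i v c' \<Longrightarrow> c \<noteq> c' \<Longrightarrow> q \<le> bot"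
    and \<sigma>: "p \<le> baire \<sigma>" "p \<le> Stp \<sigma>"
    and sec: "p \<le> secured_from E \<delta> \<alpha> \<sigma> []"
  shows "p \<le> perhaps \<sigma> (En \<delta>) \<alpha>"
proof -
  \<comment> \<open>The claim is generalised over the part \<open>g\<close> of
    \<open>\<gamma>\<close> already used: agreement has failed along \<open>g\<close>, and what is
    left of the stump secures all continuations of \<open>g\<close>.\<close>
  define A where "A = (\<lambda>\<sigma>. \<^bold>\<forall>g.
    (\<^bold>\<forall>j. tv (j < length g) \<^bold>\<longrightarrow> (same_init \<alpha> (subseq \<delta> j) (g ! j) \<^bold>\<longrightarrow> bot)) \<^bold>\<and>
    secured_from E \<delta> \<alpha> \<sigma> g \<^bold>\<longrightarrow> perhaps \<sigma> (En \<delta>) \<alpha>)"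
  have A: "q \<le> perhaps \<sigma> (En \<delta>) \<alpha>"
    if "q \<le> A \<sigma>" "\<And>j. j < length g \<Longrightarrow> q \<le> (same_init \<alpha> (subseq \<delta> j) (g ! j) \<^bold>\<longrightarrow> bot)"
      "q \<le> secured_from E \<delta> \<alpha> \<sigma> g" for q \<sigma> g
    by (rule himp_mp[OF hallD[OF that(1)[unfolded A_def], of g]])
       (use that in \<open>auto intro!: hallI tv_himpI\<close>)
  have "p \<le> (\<^bold>\<forall>\<N> \<sigma>. stump_step A \<sigma> \<^bold>\<longrightarrow> A \<sigma>)"
  proof (rule sallI, rule himpI, unfold A_def, rule hallI, rule himpI, fold A_def)
    fix \<sigma> q0 q1 g q
    assume le: "q0 \<le> p" "q1 \<le> q0" "q \<le> q1" and \<sigma>: "q0 \<le> baire \<sigma>"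
      and step: "q1 \<le> stump_step A \<sigma>"
      and hyp: "q \<le> ((\<^bold>\<forall>j. tv (j < length g) \<^bold>\<longrightarrow> (same_init \<alpha> (subseq \<delta> j) (g ! j) \<^bold>\<longrightarrow> bot)) \<^bold>\<and>
        secured_from E \<delta> \<alpha> \<sigma> g)"
    have qp: "q \<le> p" using le by simp
    have \<sigma>: "q \<le> baire \<sigma>" using le \<sigma> by simp
    have step: "q \<le> stump_step A \<sigma>" using le step by simp
    have sec: "q \<le> secured_from E \<delta> \<alpha> \<sigma> g" using hyp by simp
    have fails: "q \<le> (same_init \<alpha> (subseq \<delta> j) (g ! j) \<^bold>\<longrightarrow> bot)" if "j < length g" for j
      using tv_himpD[OF hallD[OF hconjD1[OF hyp]] that] .
    show "q \<le> perhaps \<sigma> (En \<delta>) \<alpha>"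
      using step unfolding stump_step_def
    proof (rule hdisjE)
      fix r assume rq: "r \<le> q" and nz: "r \<le> nonzero_at \<sigma> []"
      \<comment> \<open>An empty stump cannot secure anything: some continuation of \<open>g\<close>
        exists, here by zeros, and securing it would force \<open>\<sigma>\<close> to be zero at the
        empty sequence.\<close>
      define \<gamma> :: "'a seq" where "\<gamma> = (\<lambda>i m. tv (m = (if i < length g then g ! i else 0)))"
      have b\<gamma>: "r \<le> baire \<gamma>"
      proof (rule baireI)
        show "r \<le> (\<^bold>\<exists>m. \<gamma> n m)" for n
          unfolding \<gamma>_def by (rule le_hex[where x = "if n < length g then g ! n else 0"]) (simp add: tvI)
      qed (auto simp: \<gamma>_def elim!: tvE)
      have "r \<le> init \<gamma> (length g) g"
        by (rule initI) (auto simp: \<gamma>_def tvI)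
      then show "r \<le> perhaps \<sigma> (En \<delta>) \<alpha>"
      proof (rule secured_fromE[OF sec[THEN order.trans[OF rq]] b\<gamma>])
        fix w s j u assume ur: "u \<le> r" and ad: "u \<le> admits \<sigma> (drop (length g) s)"
        show "u \<le> perhaps \<sigma> (En \<delta>) \<alpha>"
          by (rule zero_nonzero_absurd[OF _ admits_Nil[OF ad]])
             (use ur rq nz \<sigma> order.trans in blast)+
      qed
    next
      fix r assume rq: "r \<le> q" and *: "r \<le> (zero_at \<sigma> [] \<^bold>\<and> (\<^bold>\<forall>n. A (subseq \<sigma> n)))"
      have rp: "r \<le> p" using rq qp by (rule order.trans)
      note b = b[THEN order.trans[OF rp]]
      have IH: "r \<le> A (subseq \<sigma> n)" for n
        using hallD[OF hconjD2[OF *]] .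
      \<comment> \<open>The first enumerated sequence not yet excluded by \<open>g\<close> is the
        witness for the perhapsive extension.\<close>
      let ?d = "subseq \<delta> (length g)"
      have bd: "r \<le> baire ?d" using b(2) by (rule le_baire_subseq)
      have "r \<le> (apart \<alpha> ?d \<^bold>\<longrightarrow> (\<^bold>\<exists>m. perhaps (subseq \<sigma> m) (En \<delta>) \<alpha>))"
      proof (rule himpI, erule apartE)
        fix u0 i m m' u
        assume "u0 \<le> r" "u \<le> u0" and \<alpha>: "u \<le> \<alpha> i m" and \<delta>: "u \<le> ?d i m'" and ne: "m \<noteq> m'"
        then have ur: "u \<le> r" by simp
        have up: "u \<le> p" using ur rp by (rule order.trans)
        have uq: "u \<le> q" using ur rq by (rule order.trans)
        \<comment> \<open>An initial part of length \<open>Suc i\<close> is just long enough to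
          contain the place \<open>i\<close> where \<open>\<alpha>\<close> and \<open>?d\<close>
          differ.\<close>
        have new: "v \<le> bot" if vu: "v \<le> u" and "v \<le> same_init \<alpha> ?d (Suc i)" for v
          using that(2)
        proof (rule same_initE)
          fix s x assume xv: "x \<le> v" and s: "x \<le> init \<alpha> (Suc i) s" "x \<le> init ?d (Suc i) s"
          have xu: "x \<le> u" using xv vu by (rule order.trans)
          show "x \<le> bot"
            by (rule baire_single[OF b(1)[THEN order.trans[OF order.trans[OF xu ur]]]
                  \<alpha>[THEN order.trans[OF xu]] init_nth[OF s(1), of i, simplified]],
                rule baire_single[OF bd[THEN order.trans[OF order.trans[OF xu ur]]]
                  \<delta>[THEN order.trans[OF xu]] init_nth[OF s(2), of i, simplified]])
               (use ne in simp)
        qed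
        show "u \<le> (\<^bold>\<exists>m. perhaps (subseq \<sigma> m) (En \<delta>) \<alpha>)"
        \<comment> \<open>The next value of \<open>\<gamma>\<close> is chosen as
          \<open>Suc i\<close>, which makes agreement fail at the place \<open>length g\<close>; its
          label \<open>c\<close> names the substump for the induction hypothesis.\<close>
        proof (rule hexE[OF total[THEN order.trans[OF up], of "length g" "Suc i"]])
          fix c v assume vu: "v \<le> u" and c: "v \<le> E (length g) (Suc i) c"
          note fails = fails[THEN order.trans[OF order.trans[OF vu uq]]]
          have "v \<le> secured_from E \<delta> \<alpha> (subseq \<sigma> c) (g @ [Suc i])"
            by (rule secured_from_extend[OF sec[THEN order.trans[OF order.trans[OF vu uq]]] fails single c])
               (use vu up in auto)
          moreover have "v \<le> (same_init \<alpha> (subseq \<delta> j) ((g @ [Suc i]) ! j) \<^bold>\<longrightarrow> bot)"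
            if "j < length (g @ [Suc i])" for j
          proof (cases "j < length g")
            case True
            then show ?thesis using fails by (simp add: nth_append)
          next
            case False
            then have "j = length g" using that by simp
            then show ?thesis using new vu by (auto intro!: himpI)
          qed
          ultimately have "v \<le> perhaps (subseq \<sigma> c) (En \<delta>) \<alpha>"
            using IH[THEN order.trans[OF order.trans[OF vu ur]]] by (blast intro: A)
          then show "v \<le> (\<^bold>\<exists>m. perhaps (subseq \<sigma> m) (En \<delta>) \<alpha>)" by (rule le_hex)
        qed
      qed
      moreover have "r \<le> En \<delta> ?d"
        unfolding En_def by (rule le_hex[where x = "length g"], rule seq_eq_refl[OF bd])
      ultimately have "r \<le> (\<^bold>\<exists>\<N> \<beta>. En \<delta> \<beta> \<^bold>\<and> (apart \<alpha> \<beta> \<^bold>\<longrightarrow> (\<^bold>\<exists>m. perhaps (subseq \<sigma> m) (En \<delta>) \<alpha>)))"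
        by (intro sexI[OF bd] inf_greatest)
      then show "r \<le> perhaps \<sigma> (En \<delta>) \<alpha>"
        unfolding perhaps_unfold[of \<sigma>] using * by (intro le_supI2) simp
    qed
  qed
  from Stp_induct[OF this] have "p \<le> (Stp \<sigma> \<^bold>\<longrightarrow> A \<sigma>)"
    using \<sigma>(1) by (rule sallD)
  then have "p \<le> A \<sigma>" using \<sigma>(2) by (rule himp_mp)
  then show ?thesis by (rule A[where g = "[]"]) (simp_all add: sec)
qed

lemma secures_perhaps:
  assumes "p \<le> baire \<sigma>" "p \<le> Stp \<sigma>" "p \<le> baire \<delta>" "p \<le> baire \<alpha>" "p \<le> secures \<sigma> \<delta> \<alpha>"
  shows "p \<le> perhaps \<sigma> (En \<delta>) \<alpha>"
proof (rule secured_perhaps[where E = "\<lambda>i v c. tv (v = c)"])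
  show "p \<le> (\<^bold>\<exists>c. tv (v = c))" for v :: nat
    by (rule le_hex[where x = v]) (simp add: tvI)
  show "p \<le> secured_from (\<lambda>i v c. tv (v = c)) \<delta> \<alpha> \<sigma> []"
  proof (rule secured_fromI)
    fix \<gamma> q assume qp: "q \<le> p" and b: "q \<le> baire \<gamma>"
    have "q \<le> (\<^bold>\<exists>n. (\<^bold>\<exists>s. init \<gamma> (n + 1) s \<^bold>\<and> admits \<sigma> s) \<^bold>\<and> agree_upto \<delta> \<alpha> \<gamma> n)"
      using order.trans[OF qp assms(5)] b unfolding secures_def by (rule sallD)
    then show "q \<le> secured_along (\<lambda>i v c. tv (v = c)) \<delta> \<alpha> \<sigma> [] \<gamma>" (is "_ \<le> ?goal")
    proof (rule hexE)
      fix n r assume rq: "r \<le> q"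
        and *: "r \<le> ((\<^bold>\<exists>s. init \<gamma> (n + 1) s \<^bold>\<and> admits \<sigma> s) \<^bold>\<and> agree_upto \<delta> \<alpha> \<gamma> n)"
      have "r \<le> (\<^bold>\<exists>k s. (init \<gamma> (n + 1) s \<^bold>\<and> admits \<sigma> s) \<^bold>\<and> (\<gamma> n k \<^bold>\<and> same_init \<alpha> (subseq \<delta> n) k))"
        using * unfolding agree_upto_def hex_inf_distrib inf_hex_distrib .
      then show "r \<le> ?goal"
      proof (elim hexE)
        fix k u s v
        assume ur: "u \<le> r" and vu: "v \<le> u"
          and sk: "v \<le> ((init \<gamma> (n + 1) s \<^bold>\<and> admits \<sigma> s) \<^bold>\<and> (\<gamma> n k \<^bold>\<and> same_init \<alpha> (subseq \<delta> n) k))"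
        note s = hconjD1[OF sk] and k = hconjD2[OF sk]
        have ini: "v \<le> init \<gamma> (n + 1) s" and ad: "v \<le> admits \<sigma> s"
          using s by simp_all
        have b: "v \<le> baire \<gamma>" using b rq ur vu by (meson order.trans)
        show "v \<le> ?goal"
        proof (rule init_length[OF ini], rule baire_single[OF b hconjD1[OF k] init_nth[OF ini]])
          assume "length s = n + 1" "k = s ! n"
          then show "v \<le> ?goal"
            using ini ad k by (intro secured_alongI[where E = "\<lambda>i v c. tv (v = c)" and w = s and s = s and j = n]) (auto intro: tvI)
        qed simp
      qed
    qed
  qed
qed (use assms in \<open>auto elim!: tvE\<close>)

section \<open>Decidable propositions and Brouwer's Thesis\<close>

text \<open>Excluded middle for one proposition, as a truth value. A bar has to satisfy it in order
  to be given by an element of Baire space.\<close>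

definition decided :: "'h::complete_heyting_algebra \<Rightarrow> 'h" where
  "decided a = (a \<^bold>\<or> (a \<^bold>\<longrightarrow> bot))"

lemma decidedI1: "p \<le> a \<Longrightarrow> p \<le> decided a"
  unfolding decided_def by (rule le_supI1)

lemma decidedI2: "(\<And>q. q \<le> p \<Longrightarrow> q \<le> a \<Longrightarrow> q \<le> bot) \<Longrightarrow> p \<le> decided a"
  unfolding decided_def by (intro le_supI2 himpI)

lemma decidedE:
  assumes "p \<le> decided a"
    and "\<And>q. q \<le> p \<Longrightarrow> q \<le> a \<Longrightarrow> q \<le> \<psi>" and "\<And>q. q \<le> p \<Longrightarrow> q \<le> (a \<^bold>\<longrightarrow> bot) \<Longrightarrow> q \<le> \<psi>"
  shows "p \<le> \<psi>"
  using assms unfolding decided_def by (rule hdisjE)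

lemma decided_tv: "p \<le> decided (tv b)"
  by (cases b) (auto intro: decidedI1 decidedI2 simp: tv_def)

lemma decided_conj:
  assumes "p \<le> decided a" "p \<le> decided b" shows "p \<le> decided (a \<^bold>\<and> b)"
proof (rule decidedE[OF assms(1)])
  fix q assume qp: "q \<le> p" and a: "q \<le> a"
  show "q \<le> decided (a \<^bold>\<and> b)"
  proof (rule decidedE[OF order.trans[OF qp assms(2)]])
    show "r \<le> decided (a \<^bold>\<and> b)" if "r \<le> q" "r \<le> b" for r
      using that a by (intro decidedI1) auto
    show "r \<le> decided (a \<^bold>\<and> b)" if "r \<le> q" "r \<le> (b \<^bold>\<longrightarrow> bot)" for r
      using that(2) by (intro decidedI2) (meson hconjD2 himp_mp order.trans)
  qed
next
  fix q assume "q \<le> (a \<^bold>\<longrightarrow> bot)"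
  then show "q \<le> decided (a \<^bold>\<and> b)"
    by (intro decidedI2) (meson hconjD1 himp_mp order.trans)
qed

lemma decided_disj:
  assumes "p \<le> decided a" "p \<le> decided b" shows "p \<le> decided (a \<^bold>\<or> b)"
proof (rule decidedE[OF assms(1)])
  fix q assume "q \<le> a"
  then show "q \<le> decided (a \<^bold>\<or> b)" by (intro decidedI1 le_supI1)
next
  fix q assume qp: "q \<le> p" and a: "q \<le> (a \<^bold>\<longrightarrow> bot)"
  show "q \<le> decided (a \<^bold>\<or> b)"
  proof (rule decidedE[OF order.trans[OF qp assms(2)]])
    show "r \<le> decided (a \<^bold>\<or> b)" if "r \<le> b" for r
      using that by (intro decidedI1 le_supI2)
    fix r assume rq: "r \<le> q" and b: "r \<le> (b \<^bold>\<longrightarrow> bot)"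
    show "r \<le> decided (a \<^bold>\<or> b)"
    proof (rule decidedI2, erule hdisjE)
      show "v \<le> bot" if "u \<le> r" "v \<le> u" "v \<le> a" for u v
        using himp_mp[of v a bot] that a rq by (meson order.trans)
      show "v \<le> bot" if "u \<le> r" "v \<le> u" "v \<le> b" for u v
        using himp_mp[of v b bot] that b by (meson order.trans)
    qed
  qed
qed

text \<open>The bound is a standard number, so the existential is a finite disjunction; the
  induction splits off its last member.\<close>

lemma decided_bounded_ex:
  assumes "\<And>j. p \<le> decided (\<phi> j)"
  shows "p \<le> decided (\<^bold>\<exists>j. tv (j < (n::nat)) \<^bold>\<and> \<phi> j)"
proof (induction n)
  case 0
  have "(\<^bold>\<exists>j. tv (j < (0::nat)) \<^bold>\<and> \<phi> j) = tv False"
    by (simp add: hex_def tv_def)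
  then show ?case by (simp only: decided_tv)
next
  case (Suc n)
  have "(\<^bold>\<exists>j. tv (j < Suc n) \<^bold>\<and> \<phi> j) = ((\<^bold>\<exists>j. tv (j < n) \<^bold>\<and> \<phi> j) \<^bold>\<or> \<phi> n)" (is "?l = ?r")
  proof (rule order.antisym)
    have "(tv (j < Suc n) \<^bold>\<and> \<phi> j) \<le> ?r" for j
    proof -
      consider "j < n" | "j = n" | "\<not> j < Suc n" by linarith
      then show ?thesis
        by cases (auto simp: tv_def intro!: le_supI1[OF le_hex[where x = j]])
    qed
    then show "?l \<le> ?r" by (rule hex_le)
    show "?r \<le> ?l"
      by (intro sup_least hex_le)
         (rule le_hex, rule inf_mono[OF _ order_refl], simp add: tv_def,
          rule le_hex[where x = n], simp add: tv_def)
  qed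
  then show ?case using decided_disj[OF Suc assms[of n]] by simp
qed

lemma decided_nonzero_at:
  assumes "p \<le> baire \<beta>" shows "p \<le> decided (nonzero_at \<beta> s)"
proof (rule hdisjE[OF zero_nonzero_cases[OF assms, of s]])
  fix q assume qp: "q \<le> p" and z: "q \<le> zero_at \<beta> s"
  show "q \<le> decided (nonzero_at \<beta> s)"
    by (rule decidedI2, rule zero_nonzero_absurd[of _ \<beta> s])
       (use qp z assms in \<open>auto intro: order.trans\<close>)
qed (rule decidedI1)

lemma decided_init:
  assumes "p \<le> baire \<alpha>" shows "p \<le> decided (init \<alpha> n s)"
proof (rule hexE[OF init_ex[OF assms, of n]])
  fix t q assume qp: "q \<le> p" and t: "q \<le> init \<alpha> n t"
  show "q \<le> decided (init \<alpha> n s)"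
  proof (cases "s = t")
    case True
    then show ?thesis using t by (simp add: decidedI1)
  next
    case False
    show ?thesis
      by (rule decidedI2, rule init_unique[of _ \<alpha> n s t])
         (use qp t assms False in \<open>auto intro: order.trans\<close>)
  qed
qed

lemma decided_same_init:
  assumes "p \<le> baire \<alpha>" "p \<le> baire \<beta>" shows "p \<le> decided (same_init \<alpha> \<beta> n)"
  using same_init_cases[OF assms, of n] unfolding decided_def
  by (rule order.trans) (simp add: le_supI2)

section \<open>Characteristic sequences of decidable bars\<close>

definition char_seq :: "(nat list \<Rightarrow> 'h::complete_heyting_algebra) \<Rightarrow> 'h seq" where
  "char_seq D n m =
    (if m = 0 then D (list_decode n) \<^bold>\<longrightarrow> bot else if m = 1 then D (list_decode n) else bot)"

text \<open>Totality at a place is excluded middle for \<open>D\<close> there, with value 1 inside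
  and value 0 outside; single-valuedness says that \<open>D\<close> and its negation exclude each
  other.\<close>

lemma baire_char_seq:
  assumes "\<And>s. p \<le> decided (D s)" shows "p \<le> baire (char_seq D)"
proof (rule baireI)
  fix n
  show "p \<le> (\<^bold>\<exists>m. char_seq D n m)"
    by (rule decidedE[OF assms[of "list_decode n"]])
       (rule le_hex[where x = 1], simp add: char_seq_def,
        rule le_hex[where x = 0], simp add: char_seq_def)
next
  fix n m m' q
  assume "q \<le> char_seq D n m" "q \<le> char_seq D n m'" "m \<noteq> m'"
  then show "q \<le> bot"
    by (auto simp: char_seq_def split: if_splits intro: himp_mp)
qed

lemma nonzero_at_char_seq: "nonzero_at (char_seq D) s = D s"
proof (rule order.antisym)
  show "nonzero_at (char_seq D) s \<le> D s"
    unfolding nonzero_at_def by (rule hex_le) (auto simp: char_seq_def tv_def)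
  show "D s \<le> nonzero_at (char_seq D) s"
    unfolding nonzero_at_def by (rule le_hex[where x = 1]) (simp add: char_seq_def tv_def)
qed

text \<open>The Thesis is applied to \<open>char_seq D\<close>. Its nonzero places form the set
  \<open>D\<close> itself, so the conclusion translates back without loss.\<close>

lemma bar_stump:
  assumes "valid (brouwer_thesis :: 'h::complete_heyting_algebra)"
    and D: "\<And>s. p \<le> decided (D s :: 'h)"
    and bar: "\<And>\<gamma> q. q \<le> p \<Longrightarrow> q \<le> baire \<gamma> \<Longrightarrow> q \<le> (\<^bold>\<exists>n s. init \<gamma> n s \<^bold>\<and> D s)"
  shows "p \<le> (\<^bold>\<exists>\<N> \<sigma>. Stp \<sigma> \<^bold>\<and> (\<^bold>\<forall>\<N> \<gamma>. \<^bold>\<exists>n s. init \<gamma> n s \<^bold>\<and> D s \<^bold>\<and> admits \<sigma> s))"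
proof -
  have "p \<le> (\<^bold>\<forall>\<N> \<gamma>. \<^bold>\<exists>n s. init \<gamma> n s \<^bold>\<and> nonzero_at (char_seq D) s)"
    unfolding nonzero_at_char_seq by (rule sallI) (rule bar)
  then show ?thesis
    using himp_mp[OF sallD[OF validD[OF assms(1), of p, unfolded brouwer_thesis_def]
          baire_char_seq[of p D, OF D]]]
    unfolding nonzero_at_char_seq by blast
qed

section \<open>Almost-enumerable sets are unions of perhapsive extensions\<close>

lemma Almost_perhaps:
  assumes bt: "valid (brouwer_thesis :: 'h::complete_heyting_algebra)"
    and b: "p \<le> baire \<delta>" "p \<le> baire \<alpha>" and al: "p \<le> Almost \<delta> (\<alpha> :: 'h seq)"
  shows "p \<le> (\<^bold>\<exists>\<N> \<sigma>. Stp \<sigma> \<^bold>\<and> perhaps \<sigma> (En \<delta>) \<alpha>)"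
proof -
  \<comment> \<open>The last entry of a sequence of length \<open>n + 1\<close> is the value at
    \<open>n\<close>, and it is compared against \<open>\<delta>\<^sup>n\<close>; hence the index
    \<open>length s - 1\<close>.\<close>
  define D where
    "D s = (tv (s \<noteq> []) \<^bold>\<and> same_init \<alpha> (subseq \<delta> (length s - 1)) (last s))" for s
  have "p \<le> decided (D s)" for s
    unfolding D_def by (intro decided_conj decided_tv decided_same_init b le_baire_subseq)
  moreover have "q \<le> (\<^bold>\<exists>n s. init \<gamma> n s \<^bold>\<and> D s)" if qp: "q \<le> p" and \<gamma>: "q \<le> baire \<gamma>" for \<gamma> q
  proof -
    have "q \<le> (\<^bold>\<exists>n. agree_upto \<delta> \<alpha> \<gamma> n)"
      using order.trans[OF qp al] \<gamma> unfolding Almost_def by (rule sallD)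
    then show ?thesis
      unfolding agree_upto_def
    proof (elim hexE)
      fix n q1 k r assume "q1 \<le> q" "r \<le> q1" and k: "r \<le> (\<gamma> n k \<^bold>\<and> same_init \<alpha> (subseq \<delta> n) k)"
      then have "r \<le> q" by simp
      note \<gamma> = \<gamma>[THEN order.trans[OF this]]
      show "r \<le> (\<^bold>\<exists>n s. init \<gamma> n s \<^bold>\<and> D s)"
      proof (rule hexE[OF init_ex[OF \<gamma>, of "Suc n"]])
        fix s u assume ur: "u \<le> r" and s: "u \<le> init \<gamma> (Suc n) s"
        note \<gamma> = \<gamma>[THEN order.trans[OF ur]] and k = k[THEN order.trans[OF ur]]
        show "u \<le> (\<^bold>\<exists>n s. init \<gamma> n s \<^bold>\<and> D s)"
        proof (rule init_length[OF s], rule baire_single[OF \<gamma> hconjD1[OF k] init_nth[OF s]])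
          assume l: "length s = Suc n" "k = s ! n"
          then have "last s = k" "s \<noteq> []"
            by (cases s; auto simp: last_conv_nth)+
          then have "u \<le> D s" using k l by (simp add: D_def tvI)
          then show "u \<le> (\<^bold>\<exists>n s. init \<gamma> n s \<^bold>\<and> D s)"
            using s by (intro le_hex[where x = "Suc n"] le_hex[where x = s]) simp
        qed simp
      qed
    qed
  qed
  ultimately have "p \<le> (\<^bold>\<exists>\<N> \<sigma>. Stp \<sigma> \<^bold>\<and> (\<^bold>\<forall>\<N> \<gamma>. \<^bold>\<exists>n s. init \<gamma> n s \<^bold>\<and> D s \<^bold>\<and> admits \<sigma> s))"
    by (rule bar_stump[OF bt])
  then show ?thesis
  proof (rule sexE)
    fix \<sigma> q assume qp: "q \<le> p" and \<sigma>: "q \<le> baire \<sigma>"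
      and *: "q \<le> (Stp \<sigma> \<^bold>\<and> (\<^bold>\<forall>\<N> \<gamma>. \<^bold>\<exists>n s. init \<gamma> n s \<^bold>\<and> D s \<^bold>\<and> admits \<sigma> s))"
    have "q \<le> secures \<sigma> \<delta> \<alpha>"
      unfolding secures_def
    proof (rule sallI)
      fix \<gamma> r assume rq: "r \<le> q" and \<gamma>: "r \<le> baire \<gamma>"
      have "r \<le> (\<^bold>\<exists>n s. init \<gamma> n s \<^bold>\<and> D s \<^bold>\<and> admits \<sigma> s)"
        using order.trans[OF rq hconjD2[OF *]] \<gamma> by (rule sallD)
      then show "r \<le> (\<^bold>\<exists>n. (\<^bold>\<exists>s. init \<gamma> (n + 1) s \<^bold>\<and> admits \<sigma> s) \<^bold>\<and> agree_upto \<delta> \<alpha> \<gamma> n)"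
        (is "_ \<le> ?goal")
      proof (elim hexE)
        fix n r1 s u assume "u \<le> (init \<gamma> n s \<^bold>\<and> D s \<^bold>\<and> admits \<sigma> s)"
        then have ini: "u \<le> init \<gamma> n s" and ad: "u \<le> admits \<sigma> s" and ne: "u \<le> tv (s \<noteq> [])"
          and same: "u \<le> same_init \<alpha> (subseq \<delta> (length s - 1)) (last s)"
          by (simp_all add: D_def)
        show "u \<le> ?goal"
        proof (rule init_length[OF ini], rule tvE[OF ne])
          assume l: "length s = n" and "s \<noteq> []"
          \<comment> \<open>Members of the bar are non-empty, so the length is a successor and the
            agreement sits at the place \<open>m\<close> before it.\<close>
          then obtain m where n: "n = m + 1" by (cases n) auto
          have "u \<le> \<gamma> m (last s)"
            using init_nth[OF ini, of m] l n \<open>s \<noteq> []\<close> by (simp add: last_conv_nth)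
          then have "u \<le> agree_upto \<delta> \<alpha> \<gamma> m"
            unfolding agree_upto_def using same l n by (intro le_hex[where x = "last s"]) simp
          then show "u \<le> ?goal"
            using ini ad n
            by (intro le_hex[where x = m] inf_greatest le_hex[where x = s]) auto
        qed
      qed
    qed
    then have "q \<le> perhaps \<sigma> (En \<delta>) \<alpha>"
      using \<sigma> hconjD1[OF *] b[THEN order.trans[OF qp]] by (intro secures_perhaps)
    then show "q \<le> (\<^bold>\<exists>\<N> \<sigma>. Stp \<sigma> \<^bold>\<and> perhaps \<sigma> (En \<delta>) \<alpha>)"
      using \<sigma> hconjD1[OF *] by (intro sexI[of _ \<sigma>] inf_greatest)
  qed
qed

section \<open>From perhapsive extensions back to almost-enumerability\<close>

lemma En_agree:
  assumes "p \<le> baire \<alpha>" "p \<le> baire \<delta>" "p \<le> seq_eq \<alpha> (subseq \<delta> n)"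
  shows "p \<le> same_init \<alpha> (subseq \<delta> n) k"
proof -
  note b = assms(1) le_baire_subseq[OF assms(2), of n]
  show ?thesis
  \<comment> \<open>Agreement up to \<open>k\<close> is decidable, and the alternative is apartness.
    At the place of apartness \<open>seq_eq\<close> supplies a common value, which contradicts
    single-valuedness.\<close>
  proof (rule hdisjE[OF same_init_cases[OF b, of k]])
    fix q assume qp: "q \<le> p"
      and "q \<le> (apart \<alpha> (subseq \<delta> n) \<^bold>\<and> (same_init \<alpha> (subseq \<delta> n) k \<^bold>\<longrightarrow> bot))"
    from this(2)[THEN hconjD1] show "q \<le> same_init \<alpha> (subseq \<delta> n) k"
    proof (rule apartE)
      fix i m m' r
      assume rq: "r \<le> q" and m: "r \<le> \<alpha> i m" "r \<le> subseq \<delta> n i m'" "m \<noteq> m'"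
      have rp: "r \<le> p" using rq qp by (rule order.trans)
      show "r \<le> same_init \<alpha> (subseq \<delta> n) k"
      proof (rule hexE[OF hallD[OF order.trans[OF rp assms(3)[unfolded seq_eq_def]], of i]])
        fix x u assume ur: "u \<le> r" and x: "u \<le> (\<alpha> i x \<^bold>\<and> subseq \<delta> n i x)"
        have up: "u \<le> p" using ur rp by (rule order.trans)
        note b = b[THEN order.trans[OF up]]
        show "u \<le> same_init \<alpha> (subseq \<delta> n) k"
          by (rule baire_single[OF b(1) order.trans[OF ur m(1)] hconjD1[OF x]],
              rule baire_single[OF b(2) order.trans[OF ur m(2)] hconjD2[OF x]])
             (use m(3) in simp)
      qed
    qed
  qed
qed

lemma En_apart:
  assumes "p \<le> baire \<delta>" "p \<le> apart \<alpha> (subseq \<delta> n)" "p \<le> seq_eq \<beta> (subseq \<delta> n)"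
  shows "p \<le> apart \<alpha> \<beta>"
  using assms(2)
proof (rule apartE)
  fix i m m' r
  assume rp: "r \<le> p" and m: "r \<le> \<alpha> i m" "r \<le> subseq \<delta> n i m'" "m \<noteq> m'"
  show "r \<le> apart \<alpha> \<beta>"
  proof (rule hexE[OF hallD[OF order.trans[OF rp assms(3)[unfolded seq_eq_def]], of i]])
    fix x u assume ur: "u \<le> r" and x: "u \<le> (\<beta> i x \<^bold>\<and> subseq \<delta> n i x)"
    have "u \<le> baire (subseq \<delta> n)"
      using le_baire_subseq[OF assms(1)] ur rp by (meson order.trans)
    from baire_single[OF this order.trans[OF ur m(2)] hconjD2[OF x]] show "u \<le> apart \<alpha> \<beta>"
      by this (use m x ur in \<open>auto intro!: apartI[of _ _ i m _ x] intro: order.trans\<close>)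
  qed
qed

text \<open>Stump induction for fixed \<open>\<alpha>\<close>. For a given \<open>\<gamma>\<close>
  let \<open>\<delta>\<^sup>n\<close> be the witness of the perhapsive extension and
  \<open>k\<close> the value of \<open>\<gamma>\<close> at \<open>n\<close>. It is decidable whether
  \<open>\<alpha>\<close> and \<open>\<delta>\<^sup>n\<close> agree up to \<open>k\<close>: if so,
  \<open>n\<close> is as required; if not, they are apart, and \<open>\<alpha>\<close> lies in the
  extension for some substump. For an empty stump \<open>\<alpha>\<close> equals some
  \<open>\<delta>\<^sup>n\<close>.\<close>

lemma perhaps_Almost:
  assumes b: "p \<le> baire \<delta>" "p \<le> baire \<alpha>" and \<sigma>: "p \<le> baire \<sigma>" "p \<le> Stp \<sigma>"
    and perhaps: "p \<le> perhaps \<sigma> (En \<delta>) \<alpha>"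
  shows "p \<le> Almost \<delta> \<alpha>"
proof -
  define A where "A = (\<lambda>\<sigma>. perhaps \<sigma> (En \<delta>) \<alpha> \<^bold>\<longrightarrow> Almost \<delta> \<alpha>)"
  have "p \<le> (\<^bold>\<forall>\<N> \<sigma>. stump_step A \<sigma> \<^bold>\<longrightarrow> A \<sigma>)"
  proof (rule sallI, rule himpI, unfold A_def, rule himpI, fold A_def, unfold Almost_def, rule sallI)
    fix \<sigma> q0 q1 q2 \<gamma> q
    assume le: "q0 \<le> p" "q1 \<le> q0" "q2 \<le> q1" "q \<le> q2" and \<sigma>: "q0 \<le> baire \<sigma>"
      and step: "q1 \<le> stump_step A \<sigma>" and per: "q2 \<le> perhaps \<sigma> (En \<delta>) \<alpha>" and \<gamma>: "q \<le> baire \<gamma>"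
    have qp: "q \<le> p" and \<sigma>: "q \<le> baire \<sigma>" and step: "q \<le> stump_step A \<sigma>"
      and per: "q \<le> perhaps \<sigma> (En \<delta>) \<alpha>"
      using le \<sigma> step per by (auto intro: order.trans)
    note b = b[THEN order.trans[OF qp]]
    show "q \<le> (\<^bold>\<exists>n. agree_upto \<delta> \<alpha> \<gamma> n)"
      using per unfolding perhaps_unfold[of \<sigma>]
    proof (rule hdisjE)
      fix r assume rq: "r \<le> q" and *: "r \<le> (nonzero_at \<sigma> [] \<^bold>\<and> En \<delta> \<alpha>)"
      note b = b[THEN order.trans[OF rq]] and \<gamma> = \<gamma>[THEN order.trans[OF rq]]
      show "r \<le> (\<^bold>\<exists>n. agree_upto \<delta> \<alpha> \<gamma> n)"
      proof (rule hexE[OF hconjD2[OF *, unfolded En_def]])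
        fix n u assume ur: "u \<le> r" and n: "u \<le> seq_eq \<alpha> (subseq \<delta> n)"
        note b = b[THEN order.trans[OF ur]] and \<gamma> = \<gamma>[THEN order.trans[OF ur]]
        have "u \<le> agree_upto \<delta> \<alpha> \<gamma> n"
        proof (rule hexE[OF baire_total[OF \<gamma>, of n]])
          fix k v assume vu: "v \<le> u" and k: "v \<le> \<gamma> n k"
          show "v \<le> agree_upto \<delta> \<alpha> \<gamma> n"
            unfolding agree_upto_def
            using k order.trans[OF vu En_agree[OF b(2) b(1) n]]
            by (intro le_hex[where x = k] inf_greatest)
        qed
        then show "u \<le> (\<^bold>\<exists>n. agree_upto \<delta> \<alpha> \<gamma> n)" by (rule le_hex)
      qed
    next
      fix r assume rq: "r \<le> q" and *: "r \<le> (zero_at \<sigma> [] \<^bold>\<and>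
        (\<^bold>\<exists>\<N> \<beta>. En \<delta> \<beta> \<^bold>\<and> (apart \<alpha> \<beta> \<^bold>\<longrightarrow> (\<^bold>\<exists>m. perhaps (subseq \<sigma> m) (En \<delta>) \<alpha>))))"
      note b = b[THEN order.trans[OF rq]] and \<gamma> = \<gamma>[THEN order.trans[OF rq]]
      have IH: "r \<le> A (subseq \<sigma> n)" for n
        using order.trans[OF rq step] unfolding stump_step_def
      proof (rule hdisjE)
        show "u \<le> A (subseq \<sigma> n)" if "u \<le> r" "u \<le> nonzero_at \<sigma> []" for u
          by (rule zero_nonzero_absurd[of _ \<sigma> "[]"])
             (use that rq \<sigma> hconjD1[OF *] order.trans in blast)+
      qed (drule hconjD2, rule hallD)
      show "r \<le> (\<^bold>\<exists>n. agree_upto \<delta> \<alpha> \<gamma> n)"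
      \<comment> \<open>Unfolding exposes the index \<open>n\<close> at which the witness
        \<open>\<beta>\<close> is enumerated; folding restores \<open>En \<delta>\<close> inside
        \<open>perhaps\<close>.\<close>
      proof (rule sexE[OF hconjD2[OF *, unfolded En_def[of \<delta>, abs_def] hex_inf_distrib]], erule hexE,
          fold En_def[of \<delta>, abs_def])
        fix \<beta> u0 n u
        assume "u0 \<le> r" "u \<le> u0" and "u \<le> (seq_eq \<beta> (subseq \<delta> n) \<^bold>\<and>
          (apart \<alpha> \<beta> \<^bold>\<longrightarrow> (\<^bold>\<exists>m. perhaps (subseq \<sigma> m) (En \<delta>) \<alpha>)))"
        then have ur: "u \<le> r" and n: "u \<le> seq_eq \<beta> (subseq \<delta> n)"
          and ap: "u \<le> (apart \<alpha> \<beta> \<^bold>\<longrightarrow> (\<^bold>\<exists>m. perhaps (subseq \<sigma> m) (En \<delta>) \<alpha>))"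
          by simp_all
        note b = b[THEN order.trans[OF ur]] and \<gamma> = \<gamma>[THEN order.trans[OF ur]]
          and IH = IH[THEN order.trans[OF ur]]
        show "u \<le> (\<^bold>\<exists>n. agree_upto \<delta> \<alpha> \<gamma> n)"
        proof (rule hexE[OF baire_total[OF \<gamma>, of n]])
          fix k v assume vu: "v \<le> u" and k: "v \<le> \<gamma> n k"
          note b = b[THEN order.trans[OF vu]] and \<gamma> = \<gamma>[THEN order.trans[OF vu]]
            and IH = IH[THEN order.trans[OF vu]] and ap = ap[THEN order.trans[OF vu]]
            and n = n[THEN order.trans[OF vu]]
          show "v \<le> (\<^bold>\<exists>n. agree_upto \<delta> \<alpha> \<gamma> n)"
          proof (rule hdisjE[OF same_init_cases[OF b(2) le_baire_subseq[OF b(1)], of n k]])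
            fix x assume "x \<le> v" "x \<le> same_init \<alpha> (subseq \<delta> n) k"
            then show "x \<le> (\<^bold>\<exists>n. agree_upto \<delta> \<alpha> \<gamma> n)"
              unfolding agree_upto_def using k
              by (intro le_hex[where x = n] le_hex[where x = k]) auto
          next
            fix x assume xv: "x \<le> v"
              and "x \<le> (apart \<alpha> (subseq \<delta> n) \<^bold>\<and> (same_init \<alpha> (subseq \<delta> n) k \<^bold>\<longrightarrow> bot))"
            then have "x \<le> apart \<alpha> (subseq \<delta> n)" by simp
            note b = b[THEN order.trans[OF xv]] and \<gamma> = \<gamma>[THEN order.trans[OF xv]]
              and IH = IH[THEN order.trans[OF xv]] and ap = ap[THEN order.trans[OF xv]]
              and n = n[THEN order.trans[OF xv]]
            have "x \<le> apart \<alpha> \<beta>" by (rule En_apart) fact+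
            with ap have "x \<le> (\<^bold>\<exists>m. perhaps (subseq \<sigma> m) (En \<delta>) \<alpha>)" by (rule himp_mp)
            then have "x \<le> Almost \<delta> \<alpha>"
            proof (rule hexE)
              fix m y assume "y \<le> x" "y \<le> perhaps (subseq \<sigma> m) (En \<delta>) \<alpha>"
              then show "y \<le> Almost \<delta> \<alpha>"
                using IH[of m] unfolding A_def by (meson himp_mp order.trans)
            qed
            then show "x \<le> (\<^bold>\<exists>n. agree_upto \<delta> \<alpha> \<gamma> n)"
              unfolding Almost_def using \<gamma> by (rule sallD)
          qed
        qed
      qed
    qed
  qed
  from Stp_induct[OF this] have "p \<le> (Stp \<sigma> \<^bold>\<longrightarrow> A \<sigma>)"
    using \<sigma>(1) by (rule sallD)
  then have "p \<le> A \<sigma>" using \<sigma>(2) by (rule himp_mp)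
  then show ?thesis unfolding A_def using perhaps by (rule himp_mp)
qed

section \<open>Retracting Baire space onto a spread\<close>

definition path :: "(nat list \<Rightarrow> nat \<Rightarrow> 'h::complete_heyting_algebra) \<Rightarrow> nat list \<Rightarrow> 'h" where
  "path S t = (\<^bold>\<forall>j. tv (j < length t) \<^bold>\<longrightarrow> S (take j t) (t ! j))"

text \<open>\<open>S t y\<close> is the truth value of \<open>y\<close> being the next entry after
  \<open>t\<close>, and a path is a finite run. The infinite run is described by its finite parts:
  entry \<open>n\<close> is what follows a run of length \<open>n\<close>, which is unique when
  \<open>S\<close> is single-valued.\<close>

definition branch :: "(nat list \<Rightarrow> nat \<Rightarrow> 'h::complete_heyting_algebra) \<Rightarrow> 'h seq" where
  "branch S n y = (\<^bold>\<exists>t. tv (length t = n) \<^bold>\<and> path S (t @ [y]))"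

lemma pathI: "(\<And>j. j < length t \<Longrightarrow> p \<le> S (take j t) (t ! j)) \<Longrightarrow> p \<le> path S t"
  unfolding path_def by (intro hallI tv_himpI)

lemma path_nth: "p \<le> path S t \<Longrightarrow> j < length t \<Longrightarrow> p \<le> S (take j t) (t ! j)"
  unfolding path_def by (drule hallD, erule tv_himpD)

lemma path_take: "p \<le> path S t \<Longrightarrow> p \<le> path S (take k t)"
  by (rule pathI) (use path_nth[of p S t] in \<open>auto simp: min_def split: if_splits\<close>)

lemma path_snoc: "p \<le> path S t \<Longrightarrow> p \<le> S t y \<Longrightarrow> p \<le> path S (t @ [y])"
  by (rule pathI) (use path_nth[of p S t] in \<open>auto simp: nth_append less_Suc_eq\<close>)

text \<open>Up to the first place of difference the runs coincide, so \<open>S\<close> would allow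
  two different entries after the same list.\<close>

lemma path_unique:
  assumes single: "\<And>t y y'. p \<le> S t y \<Longrightarrow> p \<le> S t y' \<Longrightarrow> y \<noteq> y' \<Longrightarrow> p \<le> bot"
    and t: "p \<le> path S t" and t': "p \<le> path S t'" and l: "length t = length t'" and ne: "t \<noteq> t'"
  shows "p \<le> bot"
proof -
  define i where "i = (LEAST i. i < length t \<and> t ! i \<noteq> t' ! i)"
  have "\<exists>i. i < length t \<and> t ! i \<noteq> t' ! i"
    using l ne nth_equalityI by blast
  then have i: "i < length t \<and> t ! i \<noteq> t' ! i"
    unfolding i_def by (rule LeastI_ex)
  have "t ! j = t' ! j" if "j < i" for j
    using not_less_Least[OF that[unfolded i_def]] that i by auto
  then have "take i t = take i t'"
    using i l by (intro nth_equalityI) auto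
  then show ?thesis
    using single[of "take i t" "t ! i" "t' ! i"] path_nth[OF t, of i] path_nth[OF t', of i] i l
    by simp
qed

text \<open>\<open>Z\<close> is an invariant under which a run can always be continued; for the
  retraction it says that the run is still inside the spread.\<close>

lemma path_ex:
  assumes start: "p \<le> Z []"
    and step: "\<And>t q. q \<le> p \<Longrightarrow> q \<le> Z t \<Longrightarrow> q \<le> (\<^bold>\<exists>y. S t y \<^bold>\<and> Z (t @ [y]))"
  shows "p \<le> (\<^bold>\<exists>t. tv (length t = n) \<^bold>\<and> path S t \<^bold>\<and> Z t)"
proof (induction n)
  case 0
  show ?case by (rule le_hex[where x = "[]"]) (auto intro: tvI pathI start)
next
  case (Suc n)
  show ?case
  proof (rule hexE[OF Suc])
    fix t q assume qp: "q \<le> p" and t: "q \<le> (tv (length t = n) \<^bold>\<and> path S t \<^bold>\<and> Z t)"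
    then have "q \<le> (\<^bold>\<exists>y. S t y \<^bold>\<and> Z (t @ [y]))" by (intro step) simp_all
    then show "q \<le> (\<^bold>\<exists>t. tv (length t = Suc n) \<^bold>\<and> path S t \<^bold>\<and> Z t)"
    proof (rule hexE)
      fix y r assume rq: "r \<le> q" and y: "r \<le> (S t y \<^bold>\<and> Z (t @ [y]))"
      have "r \<le> tv (length (t @ [y]) = Suc n)"
        using order.trans[OF rq t] by simp
      moreover have "r \<le> path S (t @ [y])"
        using order.trans[OF rq t] y by (intro path_snoc) simp_all
      ultimately show "r \<le> (\<^bold>\<exists>t. tv (length t = Suc n) \<^bold>\<and> path S t \<^bold>\<and> Z t)"
        using y by (intro le_hex[where x = "t @ [y]"]) simp
    qed
  qed
qed

lemma init_branch: "p \<le> path S t \<Longrightarrow> p \<le> init (branch S) (length t) t"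
proof (rule initI)
  fix i assume "p \<le> path S t" "i < length t"
  then show "p \<le> branch S i (t ! i)"
    unfolding branch_def using path_take[of p S t "Suc i"]
    by (intro le_hex[where x = "take i t"]) (simp add: take_Suc_conv_app_nth tvI)
qed simp

lemma baire_branch:
  assumes total: "\<And>n. p \<le> (\<^bold>\<exists>t. tv (length t = n) \<^bold>\<and> path S t \<^bold>\<and> Z t)"
    and single: "\<And>t y y' q. q \<le> p \<Longrightarrow> q \<le> S t y \<Longrightarrow> q \<le> S t y' \<Longrightarrow> y \<noteq> y' \<Longrightarrow> q \<le> bot"
  shows "p \<le> baire (branch S)"
proof (rule baireI)
  fix n
  show "p \<le> (\<^bold>\<exists>m. branch S n m)"
  proof (rule hexE[OF total[of "Suc n"]])
    fix t q assume "q \<le> (tv (length t = Suc n) \<^bold>\<and> path S t \<^bold>\<and> Z t)"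
    then have l: "q \<le> tv (length t = Suc n)" and t: "q \<le> path S t" by simp_all
    show "q \<le> (\<^bold>\<exists>m. branch S n m)"
      by (rule tvE[OF l], rule le_hex[where x = "t ! n"])
         (use init_nth[OF init_branch[OF t], of n] in simp)
  qed
next
  fix n m m' q
  assume qp: "q \<le> p" and m: "q \<le> branch S n m" "q \<le> branch S n m'" "m \<noteq> m'"
  have "q \<le> (branch S n m \<^bold>\<and> branch S n m')" using m by simp
  then show "q \<le> bot"
    unfolding branch_def hex_inf_distrib inf_hex_distrib
  proof (elim hexE)
    fix t' q1 t r
    assume le: "q1 \<le> q" "r \<le> q1"
      and "r \<le> ((tv (length t = n) \<^bold>\<and> path S (t @ [m])) \<^bold>\<and> tv (length t' = n) \<^bold>\<and> path S (t' @ [m']))"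
    then have l: "r \<le> tv (length t = n)" "r \<le> tv (length t' = n)"
      and t: "r \<le> path S (t @ [m])" "r \<le> path S (t' @ [m'])"
      by simp_all
    show "r \<le> bot"
    proof (rule tvE[OF l(1)], rule tvE[OF l(2)], rule path_unique[OF _ t])
      show "r \<le> bot" if "r \<le> S t y" "r \<le> S t y'" "y \<noteq> y'" for t y y'
        using that le qp by (intro single[of r t y y']) auto
    qed (use m in auto)
  qed
qed

text \<open>Least number principle for a decidable property, with \<open>N\<close> as the positive
  form of its complement. By induction on \<open>n\<close>, either \<open>N\<close> holds everywhere
  below \<open>n\<close> or a least instance of \<open>P\<close> has been found.\<close>

lemma least_ex:
  assumes cases: "\<And>n. p \<le> (P n \<^bold>\<or> N n)" and ex: "p \<le> (\<^bold>\<exists>n. P n)"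
  shows "p \<le> (\<^bold>\<exists>n::nat. P n \<^bold>\<and> (\<^bold>\<forall>z. tv (z < n) \<^bold>\<longrightarrow> N z))" (is "_ \<le> ?L")
proof -
  have *: "p \<le> ((\<^bold>\<forall>z. tv (z < n) \<^bold>\<longrightarrow> N z) \<^bold>\<or> ?L)" for n
  proof (induction n)
    case 0
    show ?case by (intro le_supI1 hallI tv_himpI) simp
  next
    case (Suc n)
    show ?case
    proof (rule hdisjE[OF Suc])
      fix q assume qp: "q \<le> p" and below: "q \<le> (\<^bold>\<forall>z. tv (z < n) \<^bold>\<longrightarrow> N z)"
      show "q \<le> ((\<^bold>\<forall>z. tv (z < Suc n) \<^bold>\<longrightarrow> N z) \<^bold>\<or> ?L)"
      proof (rule hdisjE[OF order.trans[OF qp cases[of n]]])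
        fix r assume "r \<le> q" "r \<le> P n"
        then show "r \<le> ((\<^bold>\<forall>z. tv (z < Suc n) \<^bold>\<longrightarrow> N z) \<^bold>\<or> ?L)"
          using below by (intro le_supI2 le_hex[where x = n]) auto
      next
        fix r assume rq: "r \<le> q" and "r \<le> N n"
        then show "r \<le> ((\<^bold>\<forall>z. tv (z < Suc n) \<^bold>\<longrightarrow> N z) \<^bold>\<or> ?L)"
          using tv_himpD[OF hallD[OF order.trans[OF rq below]]]
          by (intro le_supI1 hallI tv_himpI) (auto simp: less_Suc_eq)
      qed
    qed (rule le_supI2)
  qed
  show ?thesis
  proof (rule hexE[OF ex])
    fix n q assume qp: "q \<le> p" and P: "q \<le> P n"
    show "q \<le> ?L"
      by (rule hdisjE[OF order.trans[OF qp *[of n]]])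
         (use P in \<open>auto intro!: le_hex[where x = n] intro: order.trans\<close>)
  qed
qed

section \<open>Spread-laws and the retraction they determine\<close>

lemma spread_law_snoc:
  assumes "p \<le> spread_law \<beta>"
  shows "p \<le> zero_at \<beta> s \<Longrightarrow> p \<le> (\<^bold>\<exists>n. zero_at \<beta> (s @ [n]))"
    and "p \<le> zero_at \<beta> (s @ [n]) \<Longrightarrow> p \<le> zero_at \<beta> s"
proof -
  have *: "p \<le> (zero_at \<beta> s \<^bold>\<longleftrightarrow> (\<^bold>\<exists>n. zero_at \<beta> (s @ [n])))"
    using assms unfolding spread_law_def by (rule hallD)
  show "p \<le> zero_at \<beta> s \<Longrightarrow> p \<le> (\<^bold>\<exists>n. zero_at \<beta> (s @ [n]))"
    using * unfolding hiff_def by (meson hconjD1 himp_mp)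
  show "p \<le> zero_at \<beta> (s @ [n]) \<Longrightarrow> p \<le> zero_at \<beta> s"
    by (rule himp_mp[OF hconjD2[OF *[unfolded hiff_def]]]) (rule le_hex)
qed

lemma spread_law_take:
  assumes "p \<le> spread_law \<beta>" shows "p \<le> zero_at \<beta> s \<Longrightarrow> p \<le> zero_at \<beta> (take k s)"
proof (induction s rule: rev_induct)
  case (snoc x s)
  then show ?case
    using spread_law_snoc(2)[OF assms snoc.prems] by (cases "k \<le> length s") auto
qed simp

text \<open>The retraction copies \<open>\<alpha>\<close> as long as this stays inside the spread, and otherwise takes the
  least admissible value.\<close>

definition retract_step ::
  "'h::complete_heyting_algebra seq \<Rightarrow> 'h seq \<Rightarrow> nat list \<Rightarrow> nat \<Rightarrow> 'h" where
  "retract_step \<beta> \<alpha> t y = (\<^bold>\<exists>x. \<alpha> (length t) x \<^bold>\<and>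
    ((zero_at \<beta> (t @ [x]) \<^bold>\<and> tv (x = y)) \<^bold>\<or>
     (nonzero_at \<beta> (t @ [x]) \<^bold>\<and> zero_at \<beta> (t @ [y]) \<^bold>\<and>
       (\<^bold>\<forall>z. tv (z < y) \<^bold>\<longrightarrow> nonzero_at \<beta> (t @ [z])))))"

text \<open>If copying the next value of \<open>\<alpha>\<close> would leave the spread, the
  spread-law still supplies an admissible value, and decidability of the law supplies a least
  one.\<close>

lemma retract_step_ex:
  assumes b: "p \<le> baire \<beta>" "p \<le> baire \<alpha>" and sp: "p \<le> spread_law \<beta>" and z: "p \<le> zero_at \<beta> t"
  shows "p \<le> (\<^bold>\<exists>y. retract_step \<beta> \<alpha> t y \<^bold>\<and> zero_at \<beta> (t @ [y]))"
proof (rule hexE[OF baire_total[OF b(2), of "length t"]])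
  fix x q assume qp: "q \<le> p" and x: "q \<le> \<alpha> (length t) x"
  note b = b[THEN order.trans[OF qp]]
  show "q \<le> (\<^bold>\<exists>y. retract_step \<beta> \<alpha> t y \<^bold>\<and> zero_at \<beta> (t @ [y]))"
  proof (rule hdisjE[OF zero_nonzero_cases[OF b(1), of "t @ [x]"]])
    fix r assume rq: "r \<le> q" and zx: "r \<le> zero_at \<beta> (t @ [x])"
    have "r \<le> retract_step \<beta> \<alpha> t x"
      unfolding retract_step_def using order.trans[OF rq x] zx
      by (intro le_hex[where x = x] inf_greatest le_supI1 tvI) simp_all
    then show "r \<le> (\<^bold>\<exists>y. retract_step \<beta> \<alpha> t y \<^bold>\<and> zero_at \<beta> (t @ [y]))"
      using zx by (intro le_hex[where x = x]) simp
  next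
    fix r assume rq: "r \<le> q" and nx: "r \<le> nonzero_at \<beta> (t @ [x])"
    have rp: "r \<le> p" using rq qp by (rule order.trans)
    have "r \<le> (\<^bold>\<exists>n. zero_at \<beta> (t @ [n]))"
      using spread_law_snoc(1)[OF sp z] rp by (rule order.trans[rotated])
    then have "r \<le> (\<^bold>\<exists>n. zero_at \<beta> (t @ [n]) \<^bold>\<and> (\<^bold>\<forall>z. tv (z < n) \<^bold>\<longrightarrow> nonzero_at \<beta> (t @ [z])))"
      by (rule least_ex[rotated]) (rule zero_nonzero_cases[OF order.trans[OF rq b(1)]])
    then show "r \<le> (\<^bold>\<exists>y. retract_step \<beta> \<alpha> t y \<^bold>\<and> zero_at \<beta> (t @ [y]))"
    proof (rule hexE)
      fix y u assume ur: "u \<le> r"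
        and y: "u \<le> (zero_at \<beta> (t @ [y]) \<^bold>\<and> (\<^bold>\<forall>z. tv (z < y) \<^bold>\<longrightarrow> nonzero_at \<beta> (t @ [z])))"
      have "u \<le> retract_step \<beta> \<alpha> t y"
        unfolding retract_step_def
        by (rule le_hex[where x = x], rule inf_greatest, use x rq ur in \<open>simp\<close>, rule le_supI2)
           (use y order.trans[OF ur nx] in simp)
      then show "u \<le> (\<^bold>\<exists>y. retract_step \<beta> \<alpha> t y \<^bold>\<and> zero_at \<beta> (t @ [y]))"
        using y by (intro le_hex[where x = y]) simp
    qed
  qed
qed

text \<open>Single-valuedness of \<open>\<alpha>\<close> identifies the value hidden in the
  definition with the given \<open>x\<close>, so two steps from the same \<open>t\<close> can be
  compared at the same \<open>x\<close>.\<close>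

lemma retract_stepE:
  assumes b: "p \<le> baire \<alpha>" and x: "p \<le> \<alpha> (length t) x"
    and y: "p \<le> retract_step \<beta> \<alpha> t y"
    and copy: "\<And>q. q \<le> p \<Longrightarrow> q \<le> zero_at \<beta> (t @ [x]) \<Longrightarrow> x = y \<Longrightarrow> q \<le> \<psi>"
    and leave: "\<And>q. q \<le> p \<Longrightarrow> q \<le> nonzero_at \<beta> (t @ [x]) \<Longrightarrow> q \<le> zero_at \<beta> (t @ [y]) \<Longrightarrow>
      (\<And>z. z < y \<Longrightarrow> q \<le> nonzero_at \<beta> (t @ [z])) \<Longrightarrow> q \<le> \<psi>"
  shows "p \<le> \<psi>"
  using y unfolding retract_step_def
proof (rule hexE)
  fix x' q assume qp: "q \<le> p" and *: "q \<le> (\<alpha> (length t) x' \<^bold>\<and>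
    ((zero_at \<beta> (t @ [x']) \<^bold>\<and> tv (x' = y)) \<^bold>\<or>
     (nonzero_at \<beta> (t @ [x']) \<^bold>\<and> zero_at \<beta> (t @ [y]) \<^bold>\<and>
       (\<^bold>\<forall>z. tv (z < y) \<^bold>\<longrightarrow> nonzero_at \<beta> (t @ [z])))))"
  note b = b[THEN order.trans[OF qp]] and x = x[THEN order.trans[OF qp]]
  show "q \<le> \<psi>"
  proof (rule baire_single[OF b x hconjD1[OF *]], rule hdisjE[OF hconjD2[OF *]])
    fix r assume "x = x'" and rq: "r \<le> q" and r: "r \<le> (zero_at \<beta> (t @ [x']) \<^bold>\<and> tv (x' = y))"
    then show "r \<le> \<psi>"
      using copy[of r] qp by (auto intro: tvE[OF hconjD2[OF r]])
  next
    fix r assume "x = x'" and rq: "r \<le> q" and r: "r \<le> (nonzero_at \<beta> (t @ [x']) \<^bold>\<and> zero_at \<beta> (t @ [y]) \<^bold>\<and>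
       (\<^bold>\<forall>z. tv (z < y) \<^bold>\<longrightarrow> nonzero_at \<beta> (t @ [z])))"
    have "r \<le> (\<^bold>\<forall>z. tv (z < y) \<^bold>\<longrightarrow> nonzero_at \<beta> (t @ [z]))" using r by simp
    then have "r \<le> nonzero_at \<beta> (t @ [z])" if "z < y" for z
      using that by (meson hallD tv_himpD)
    then show "r \<le> \<psi>"
      using leave[of r] r rq qp \<open>x = x'\<close> by auto
  qed
qed

lemma retract_step_single:
  assumes b: "p \<le> baire \<beta>" "p \<le> baire \<alpha>"
    and y: "p \<le> retract_step \<beta> \<alpha> t y" "p \<le> retract_step \<beta> \<alpha> t y'" and ne: "y \<noteq> y'"
  shows "p \<le> bot"
proof (rule hexE[OF baire_total[OF b(2), of "length t"]])
  fix x q assume qp: "q \<le> p" and x: "q \<le> \<alpha> (length t) x"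
  note b = b[THEN order.trans[OF qp]] and y = y[THEN order.trans[OF qp]]
  show "q \<le> bot"
  proof (rule retract_stepE[OF b(2) x y(1)])
    fix r assume rq: "r \<le> q" and r: "r \<le> zero_at \<beta> (t @ [x])" "x = y"
    note b = b[THEN order.trans[OF rq]] and y = y[THEN order.trans[OF rq]]
      and x = x[THEN order.trans[OF rq]]
    show "r \<le> bot"
    proof (rule retract_stepE[OF b(2) x y(2)])
      show "u \<le> bot" if "u \<le> r" "u \<le> nonzero_at \<beta> (t @ [x])" for u
        using zero_nonzero_absurd[of u \<beta> "t @ [x]"] that b r by (meson order.trans)
    qed (use ne r in simp)
  next
    fix r assume rq: "r \<le> q" and r: "r \<le> nonzero_at \<beta> (t @ [x])" "r \<le> zero_at \<beta> (t @ [y])"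
      "\<And>z. z < y \<Longrightarrow> r \<le> nonzero_at \<beta> (t @ [z])"
    note b = b[THEN order.trans[OF rq]] and y = y[THEN order.trans[OF rq]]
      and x = x[THEN order.trans[OF rq]]
    show "r \<le> bot"
    proof (rule retract_stepE[OF b(2) x y(2)])
      show "u \<le> bot" if "u \<le> r" "u \<le> zero_at \<beta> (t @ [x])" for u
        using zero_nonzero_absurd[of u \<beta> "t @ [x]"] that b r by (meson order.trans)
    next
      fix u assume ur: "u \<le> r" and u: "u \<le> zero_at \<beta> (t @ [y'])"
        "\<And>z. z < y' \<Longrightarrow> u \<le> nonzero_at \<beta> (t @ [z])"
      \<comment> \<open>The smaller value is admissible for one of the steps and rejected by the
        minimality in the other.\<close>
      have "y < y' \<or> y' < y" using ne by arith
      then show "u \<le> bot"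
        using zero_nonzero_absurd[of u \<beta> "t @ [y]"] zero_nonzero_absurd[of u \<beta> "t @ [y']"]
          ur u r b by (meson order.trans)
    qed
  qed
qed

text \<open>The image \<open>\<rho>\<close> is the infinite run of \<open>retract_step\<close>.
  Along an initial part \<open>s\<close> of \<open>\<alpha>\<close> inside the spread every shorter
  part is inside too, so each step copies and \<open>\<rho>\<close> begins with \<open>s\<close> as
  well. The hypothesis \<open>zero_at \<beta> []\<close> excludes the empty spread.\<close>

lemma spread_retract:
  assumes b: "p \<le> baire \<beta>" "p \<le> baire \<alpha>" and sp: "p \<le> spread_law \<beta>" and z: "p \<le> zero_at \<beta> []"
  shows "p \<le> (\<^bold>\<exists>\<N> \<rho>. F_set \<beta> \<rho> \<^bold>\<and>
    (\<^bold>\<forall>s. init \<alpha> (length s) s \<^bold>\<and> zero_at \<beta> s \<^bold>\<longrightarrow> init \<rho> (length s) s))"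
proof (rule sexI[of _ "branch (retract_step \<beta> \<alpha>)"])
  have total: "p \<le> (\<^bold>\<exists>t. tv (length t = n) \<^bold>\<and> path (retract_step \<beta> \<alpha>) t \<^bold>\<and> zero_at \<beta> t)" for n
    by (rule path_ex[where Z = "zero_at \<beta>", OF z], rule retract_step_ex)
       (use b sp in \<open>auto intro: order.trans\<close>)
  show "p \<le> baire (branch (retract_step \<beta> \<alpha>))"
    by (rule baire_branch[OF total], rule retract_step_single[of _ \<beta> \<alpha>])
       (use b in \<open>auto intro: order.trans\<close>)
  have "p \<le> F_set \<beta> (branch (retract_step \<beta> \<alpha>))"
    unfolding F_set_def
  proof (rule hallI, rule hexE[OF total])
    fix n t q assume *: "q \<le> (tv (length t = n) \<^bold>\<and> path (retract_step \<beta> \<alpha>) t \<^bold>\<and> zero_at \<beta> t)"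
    then have "q \<le> init (branch (retract_step \<beta> \<alpha>)) (length t) t"
      by (intro init_branch) simp
    then show "q \<le> (\<^bold>\<exists>s. init (branch (retract_step \<beta> \<alpha>)) n s \<^bold>\<and> zero_at \<beta> s)"
      by (rule_tac tvE[OF hconjD1[OF *]], rule_tac le_hex[where x = t]) (use * in auto)
  qed
  moreover have "p \<le> (\<^bold>\<forall>s. init \<alpha> (length s) s \<^bold>\<and> zero_at \<beta> s \<^bold>\<longrightarrow>
      init (branch (retract_step \<beta> \<alpha>)) (length s) s)"
  proof (rule hallI, rule himpI, rule init_branch, rule pathI)
    fix s q j assume qp: "q \<le> p" and *: "q \<le> (init \<alpha> (length s) s \<^bold>\<and> zero_at \<beta> s)" and j: "j < length s"
    have "q \<le> zero_at \<beta> (take (Suc j) s)"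
      using order.trans[OF qp sp] hconjD2[OF *] by (rule spread_law_take)
    then have "q \<le> zero_at \<beta> (take j s @ [s ! j])"
      using j by (simp add: take_Suc_conv_app_nth)
    moreover have "q \<le> \<alpha> (length (take j s)) (s ! j)"
      using init_nth[OF hconjD1[OF *] j] j by simp
    ultimately show "q \<le> retract_step \<beta> \<alpha> (take j s) (s ! j)"
      unfolding retract_step_def
      by (intro le_hex[where x = "s ! j"] inf_greatest le_supI1 tvI) simp_all
  qed
  ultimately show "p \<le> (F_set \<beta> (branch (retract_step \<beta> \<alpha>)) \<^bold>\<and>
    (\<^bold>\<forall>s. init \<alpha> (length s) s \<^bold>\<and> zero_at \<beta> s \<^bold>\<longrightarrow> init (branch (retract_step \<beta> \<alpha>)) (length s) s))"
    by (rule inf_greatest)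
qed

section \<open>A uniform stump for a spread\<close>

definition map_seq :: "(nat \<Rightarrow> nat) \<Rightarrow> 'h::complete_heyting_algebra seq \<Rightarrow> 'h seq" where
  "map_seq f \<epsilon> n x = (\<^bold>\<exists>c. \<epsilon> n c \<^bold>\<and> tv (x = f c))"

lemma map_seq_nth: "p \<le> \<epsilon> n c \<Longrightarrow> p \<le> map_seq f \<epsilon> n (f c)"
  unfolding map_seq_def by (rule le_hex[where x = c]) (simp add: tvI)

lemma baire_map_seq:
  assumes "p \<le> baire \<epsilon>" shows "p \<le> baire (map_seq f \<epsilon>)"
proof (rule baireI)
  show "p \<le> (\<^bold>\<exists>m. map_seq f \<epsilon> n m)" for n
    using baire_total[OF assms, of n] by (rule hexE) (rule le_hex, erule map_seq_nth)
next
  fix n m m' q assume qp: "q \<le> p" and m: "q \<le> map_seq f \<epsilon> n m" "q \<le> map_seq f \<epsilon> n m'" "m \<noteq> m'"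
  have "q \<le> (map_seq f \<epsilon> n m \<^bold>\<and> map_seq f \<epsilon> n m')" using m by simp
  then show "q \<le> bot"
    unfolding map_seq_def hex_inf_distrib inf_hex_distrib
  proof (elim hexE)
    fix c' q1 c r assume le: "q1 \<le> q" "r \<le> q1"
      and "r \<le> ((\<epsilon> n c \<^bold>\<and> tv (m = f c)) \<^bold>\<and> \<epsilon> n c' \<^bold>\<and> tv (m' = f c'))"
    then have c: "r \<le> \<epsilon> n c" "r \<le> \<epsilon> n c'" "r \<le> tv (m = f c)" "r \<le> tv (m' = f c')"
      by simp_all
    have "r \<le> baire \<epsilon>" using assms le qp by (meson order.trans)
    from baire_single[OF this c(1,2)] show "r \<le> bot"
      by this (rule tvE[OF c(3)], rule tvE[OF c(4)], use m in simp)
  qed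
qed

lemma init_map_seq: "p \<le> init \<epsilon> n s \<Longrightarrow> p \<le> init (map_seq f \<epsilon>) n (map f s)"
  by (rule init_length, assumption, rule initI) (auto intro: map_seq_nth dest: init_nth)

definition pair_seq :: "'h::complete_heyting_algebra seq \<Rightarrow> 'h seq \<Rightarrow> 'h seq" where
  "pair_seq \<alpha> \<gamma> n c = (\<alpha> n (fst (prod_decode c)) \<^bold>\<and> \<gamma> n (snd (prod_decode c)))"

lemma baire_pair_seq:
  assumes "p \<le> baire \<alpha>" "p \<le> baire \<gamma>" shows "p \<le> baire (pair_seq \<alpha> \<gamma>)"
proof (rule baireI)
  fix n
  have "p \<le> ((\<^bold>\<exists>a. \<alpha> n a) \<^bold>\<and> (\<^bold>\<exists>v. \<gamma> n v))"
    using assms by (simp add: baire_total)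
  then show "p \<le> (\<^bold>\<exists>m. pair_seq \<alpha> \<gamma> n m)"
    unfolding hex_inf_distrib inf_hex_distrib
  proof (elim hexE)
    fix v q a r assume "r \<le> (\<alpha> n a \<^bold>\<and> \<gamma> n v)"
    then show "r \<le> (\<^bold>\<exists>m. pair_seq \<alpha> \<gamma> n m)"
      by (intro le_hex[where x = "prod_encode (a, v)"]) (simp add: pair_seq_def)
  qed
next
  fix n m m' q assume qp: "q \<le> p" and m: "q \<le> pair_seq \<alpha> \<gamma> n m" "q \<le> pair_seq \<alpha> \<gamma> n m'" "m \<noteq> m'"
  note b = assms[THEN order.trans[OF qp]]
  note m = m[unfolded pair_seq_def]
  show "q \<le> bot"
    by (rule baire_single[OF b(1) hconjD1[OF m(1)] hconjD1[OF m(2)]],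
        rule baire_single[OF b(2) hconjD2[OF m(1)] hconjD2[OF m(2)]])
       (use m(3) in \<open>metis prod.collapse prod_decode_inverse\<close>)
qed

text \<open>In use \<open>a\<close> and \<open>g\<close> are initial parts of
  \<open>\<alpha>\<close> and \<open>\<gamma>\<close> of equal length, and
  \<open>g ! j \<le> length g\<close> makes \<open>a\<close> long enough to show the agreement. Any
  earlier place \<open>j\<close> counts, since the value of \<open>\<gamma>\<close> at
  \<open>j\<close> may ask for more of \<open>\<alpha>\<close> than is known at that moment. Only
  the list \<open>a\<close> occurs, not \<open>\<alpha>\<close>, and this makes the resulting stump
  uniform.\<close>

definition spread_bar ::
  "'h::complete_heyting_algebra seq \<Rightarrow> 'h seq \<Rightarrow> nat list \<Rightarrow> nat list \<Rightarrow> 'h" where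
  "spread_bar \<beta> \<delta> a g = (nonzero_at \<beta> a \<^bold>\<or>
    (\<^bold>\<exists>j. tv (j < length g) \<^bold>\<and> tv (g ! j \<le> length g) \<^bold>\<and> init (subseq \<delta> j) (g ! j) (take (g ! j) a)))"

lemma decided_spread_bar:
  "p \<le> baire \<beta> \<Longrightarrow> p \<le> baire \<delta> \<Longrightarrow> p \<le> decided (spread_bar \<beta> \<delta> a g)"
  unfolding spread_bar_def
  by (intro decided_disj decided_nonzero_at decided_bounded_ex decided_conj decided_tv decided_init
      le_baire_subseq)

text \<open>The first components \<open>\<alpha>\<close> are retracted to some \<open>\<rho>\<close>
  in the spread, for which agreement occurs at some \<open>j\<close>. A sufficiently long initial
  part of \<open>\<alpha>\<close> has either left the spread or is shared with
  \<open>\<rho>\<close>, and then the agreement holds for \<open>\<alpha>\<close> as well.\<close>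

lemma spread_bar_hit:
  assumes b: "p \<le> baire \<beta>" "p \<le> baire \<delta>" and sp: "p \<le> spread_law \<beta>"
    and sub: "p \<le> (\<^bold>\<forall>\<N> \<alpha>. F_set \<beta> \<alpha> \<^bold>\<longrightarrow> Almost \<delta> \<alpha>)" and \<epsilon>: "p \<le> baire \<epsilon>"
  shows "p \<le> (\<^bold>\<exists>n s. init \<epsilon> n s \<^bold>\<and>
    spread_bar \<beta> \<delta> (map (fst \<circ> prod_decode) s) (map (snd \<circ> prod_decode) s))" (is "_ \<le> ?goal")
proof (rule hdisjE[OF zero_nonzero_cases[OF b(1), of "[]"]])
  fix q assume qp: "q \<le> p" and nz: "q \<le> nonzero_at \<beta> []"
  show "q \<le> ?goal"
    by (rule le_hex[where x = 0], rule le_hex[where x = "[]"])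
       (use nz in \<open>simp add: spread_bar_def initI le_supI1\<close>)
next
  fix q assume qp: "q \<le> p" and z: "q \<le> zero_at \<beta> []"
  note b = b[THEN order.trans[OF qp]] and sp = sp[THEN order.trans[OF qp]]
    and sub = sub[THEN order.trans[OF qp]] and \<epsilon> = \<epsilon>[THEN order.trans[OF qp]]
  define \<alpha> where "\<alpha> = map_seq (fst \<circ> prod_decode) \<epsilon>"
  define \<gamma> where "\<gamma> = map_seq (snd \<circ> prod_decode) \<epsilon>"
  have \<alpha>: "q \<le> baire \<alpha>" and \<gamma>: "q \<le> baire \<gamma>"
    unfolding \<alpha>_def \<gamma>_def using \<epsilon> by (auto intro: baire_map_seq)
  show "q \<le> ?goal"
  proof (rule sexE[OF spread_retract[OF b(1) \<alpha> sp z]])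
    fix \<rho> r assume rq: "r \<le> q" and \<rho>: "r \<le> baire \<rho>"
      and *: "r \<le> (F_set \<beta> \<rho> \<^bold>\<and>
        (\<^bold>\<forall>s. init \<alpha> (length s) s \<^bold>\<and> zero_at \<beta> s \<^bold>\<longrightarrow> init \<rho> (length s) s))"
    have copy: "u \<le> init \<rho> (length s) s"
      if "u \<le> r" "u \<le> init \<alpha> (length s) s" "u \<le> zero_at \<beta> s" for u s
      using himp_mp[OF order.trans[OF that(1) hallD[OF hconjD2[OF *], of s]]] that by simp
    have "r \<le> Almost \<delta> \<rho>"
      by (rule himp_mp[OF sallD[OF order.trans[OF rq sub] \<rho>] hconjD1[OF *]])
    then have "r \<le> (\<^bold>\<exists>n. agree_upto \<delta> \<rho> \<gamma> n)"
      unfolding Almost_def using order.trans[OF rq \<gamma>] by (rule sallD)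
    then show "r \<le> ?goal"
      unfolding agree_upto_def same_init_def inf_hex_distrib
    proof (elim hexE)
      fix j r1 k r2 t u
      assume le: "r1 \<le> r" "r2 \<le> r1" "u \<le> r2"
        and "u \<le> (\<gamma> j k \<^bold>\<and> init \<rho> k t \<^bold>\<and> init (subseq \<delta> j) k t)"
      then have k: "u \<le> \<gamma> j k" and t: "u \<le> init \<rho> k t" "u \<le> init (subseq \<delta> j) k t" by simp_all
      have ur: "u \<le> r" and uq: "u \<le> q" using le rq by simp_all
      note b = b[THEN order.trans[OF uq]] and \<epsilon> = \<epsilon>[THEN order.trans[OF uq]]
        and \<gamma> = \<gamma>[THEN order.trans[OF uq]] and \<rho> = \<rho>[THEN order.trans[OF ur]]
      \<comment> \<open>Length enough to contain the place \<open>j\<close> of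
        \<open>\<gamma>\<close> and the first \<open>k\<close> values of
        \<open>\<alpha>\<close>.\<close>
      define n where "n = max (Suc j) k"
      show "u \<le> ?goal"
      proof (rule hexE[OF init_ex[OF \<epsilon>, of n]])
        fix s v assume vu: "v \<le> u" and s: "v \<le> init \<epsilon> n s"
        note b = b[THEN order.trans[OF vu]] and k = k[THEN order.trans[OF vu]]
          and \<gamma> = \<gamma>[THEN order.trans[OF vu]] and \<rho> = \<rho>[THEN order.trans[OF vu]]
          and t = t[THEN order.trans[OF vu]]
        define a where "a = map (fst \<circ> prod_decode) s"
        define g where "g = map (snd \<circ> prod_decode) s"
        have a: "v \<le> init \<alpha> n a" and g: "v \<le> init \<gamma> n g"
          unfolding a_def g_def \<alpha>_def \<gamma>_def using s by (auto intro: init_map_seq)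
        have "v \<le> spread_bar \<beta> \<delta> a g"
        proof (rule init_length[OF s], rule hdisjE[OF zero_nonzero_cases[OF b(1), of a]])
          fix x assume xv: "x \<le> v" and "length s = n" and z: "x \<le> zero_at \<beta> a"
          then have l: "length a = n" "length g = n" by (simp_all add: a_def g_def)
          have j: "j < n" and kn: "k \<le> n" by (auto simp: n_def)
          have "x \<le> init \<rho> n a"
            using copy[of x a] xv vu ur a z l by (meson order.trans)
          then have a': "x \<le> init \<rho> k (take k a)"
            using kn by (rule init_take)
          show "x \<le> spread_bar \<beta> \<delta> a g"
          proof (rule init_unique[OF order.trans[OF xv \<rho>] order.trans[OF xv t(1)] a'],
              rule baire_single[OF order.trans[OF xv \<gamma>] order.trans[OF xv k]
                order.trans[OF xv init_nth[OF g j]]])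
            assume "t = take k a" "k = g ! j"
            then show "x \<le> spread_bar \<beta> \<delta> a g"
              unfolding spread_bar_def using j kn l order.trans[OF xv t(2)]
              by (intro le_supI2 le_hex[where x = j] inf_greatest tvI) auto
          qed
        next
          fix x assume "x \<le> nonzero_at \<beta> a"
          then show "x \<le> spread_bar \<beta> \<delta> a g"
            unfolding spread_bar_def by (rule le_supI1)
        qed
        then show "v \<le> ?goal"
          using s unfolding a_def g_def
          by (intro le_hex[where x = n] le_hex[where x = s]) simp
      qed
    qed
  qed
qed

text \<open>The stump comes from the bar before any \<open>\<alpha>\<close> is given. For
  \<open>\<alpha>\<close> in the spread it is read along the pairs of values of
  \<open>\<alpha>\<close> and \<open>\<gamma>\<close>, where the bar can only be met through
  agreement.\<close>

lemma spread_Almost_perhaps: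
  assumes bt: "valid (brouwer_thesis :: 'h::complete_heyting_algebra)"
    and b: "p \<le> baire (\<beta> :: 'h seq)" "p \<le> baire \<delta>" and sp: "p \<le> spread_law \<beta>"
    and sub: "p \<le> (\<^bold>\<forall>\<N> \<alpha>. F_set \<beta> \<alpha> \<^bold>\<longrightarrow> Almost \<delta> \<alpha>)"
  shows "p \<le> (\<^bold>\<exists>\<N> \<tau>. Stp \<tau> \<^bold>\<and> (\<^bold>\<forall>\<N> \<alpha>. F_set \<beta> \<alpha> \<^bold>\<longrightarrow> perhaps \<tau> (En \<delta>) \<alpha>))"
proof -
  let ?D = "\<lambda>s. spread_bar \<beta> \<delta> (map (fst \<circ> prod_decode) s) (map (snd \<circ> prod_decode) s)"
  have "p \<le> (\<^bold>\<exists>\<N> \<sigma>. Stp \<sigma> \<^bold>\<and> (\<^bold>\<forall>\<N> \<gamma>. \<^bold>\<exists>n s. init \<gamma> n s \<^bold>\<and> ?D s \<^bold>\<and> admits \<sigma> s))"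
  proof (rule bar_stump[OF bt])
    show "p \<le> decided (?D s)" for s
      using b by (rule decided_spread_bar)
    show "q \<le> (\<^bold>\<exists>n s. init \<epsilon> n s \<^bold>\<and> ?D s)" if "q \<le> p" "q \<le> baire \<epsilon>" for \<epsilon> q
      using that b sp sub by (intro spread_bar_hit) (auto intro: order.trans)
  qed
  then show ?thesis
  proof (rule sexE)
    fix \<sigma> q assume qp: "q \<le> p" and \<sigma>: "q \<le> baire \<sigma>"
      and *: "q \<le> (Stp \<sigma> \<^bold>\<and> (\<^bold>\<forall>\<N> \<gamma>. \<^bold>\<exists>n s. init \<gamma> n s \<^bold>\<and> ?D s \<^bold>\<and> admits \<sigma> s))"
    note b = b[THEN order.trans[OF qp]]
    have "r \<le> perhaps \<sigma> (En \<delta>) \<alpha>" if rq: "r \<le> q" and \<alpha>: "r \<le> baire \<alpha>" and F: "r \<le> F_set \<beta> \<alpha>" for r \<alpha>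
    proof -
      \<comment> \<open>The label of the value \<open>v\<close> at place \<open>i\<close> codes the
        pair of the value of \<open>\<alpha>\<close> at \<open>i\<close> and \<open>v\<close>; in
        this way the choice of substump depends on \<open>\<alpha>\<close> while the stump does
        not.\<close>
      let ?E = "\<lambda>i v c. \<alpha> i (fst (prod_decode c)) \<^bold>\<and> tv (v = snd (prod_decode c))"
      note b = b[THEN order.trans[OF rq]]
      show ?thesis
      proof (rule secured_perhaps[where E = ?E])
        fix i v
        show "r \<le> (\<^bold>\<exists>c. ?E i v c)"
        proof (rule hexE[OF baire_total[OF \<alpha>, of i]])
          fix a u assume "u \<le> \<alpha> i a"
          then show "u \<le> (\<^bold>\<exists>c. ?E i v c)"
            by (intro le_hex[where x = "prod_encode (a, v)"]) (simp add: tvI)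
        qed
      next
        fix i v c c' u assume ur: "u \<le> r" and c: "u \<le> ?E i v c" "u \<le> ?E i v c'" and ne: "c \<noteq> c'"
        show "u \<le> bot"
          by (rule baire_single[OF order.trans[OF ur \<alpha>] hconjD1[OF c(1)] hconjD1[OF c(2)]],
              rule tvE[OF hconjD2[OF c(1)]], rule tvE[OF hconjD2[OF c(2)]])
             (use ne in \<open>metis prod.collapse prod_decode_inverse\<close>)
      next
        show "r \<le> secured_from ?E \<delta> \<alpha> \<sigma> []"
        proof (rule secured_fromI)
          fix \<gamma> u assume ur: "u \<le> r" and \<gamma>: "u \<le> baire \<gamma>"
          have uq: "u \<le> q" using ur rq by (rule order.trans)
          have "u \<le> (\<^bold>\<exists>n s. init (pair_seq \<alpha> \<gamma>) n s \<^bold>\<and> ?D s \<^bold>\<and> admits \<sigma> s)"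
            by (rule sallD[OF order.trans[OF uq hconjD2[OF *]]
                  baire_pair_seq[OF order.trans[OF ur \<alpha>] \<gamma>]])
          then show "u \<le> secured_along ?E \<delta> \<alpha> \<sigma> [] \<gamma>" (is "_ \<le> ?goal")
          proof (elim hexE)
            fix n u1 s v
            assume le: "u1 \<le> u" "v \<le> u1" and "v \<le> (init (pair_seq \<alpha> \<gamma>) n s \<^bold>\<and> ?D s \<^bold>\<and> admits \<sigma> s)"
            then have s: "v \<le> init (pair_seq \<alpha> \<gamma>) n s" and D: "v \<le> ?D s" and ad: "v \<le> admits \<sigma> s"
              by simp_all
            have vr: "v \<le> r" using le ur by simp
            define a where "a = map (fst \<circ> prod_decode) s"
            define g where "g = map (snd \<circ> prod_decode) s"
            show "v \<le> ?goal"
            proof (rule init_length[OF s])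
              assume ls: "length s = n"
              then have l: "length a = n" "length g = n" by (simp_all add: a_def g_def)
              have at: "v \<le> (\<alpha> i (a ! i) \<^bold>\<and> \<gamma> i (g ! i))" if "i < n" for i
                using init_nth[OF s that] that ls by (simp add: pair_seq_def a_def g_def)
              have a: "v \<le> init \<alpha> n a" and g: "v \<le> init \<gamma> n g"
                using at l by (auto intro!: initI)
              show "v \<le> ?goal"
                using D unfolding spread_bar_def a_def[symmetric] g_def[symmetric]
              proof (rule hdisjE)
                fix x assume xv: "x \<le> v" and nz: "x \<le> nonzero_at \<beta> a"
                have xr: "x \<le> r" using xv vr by (rule order.trans)
                show "x \<le> ?goal"
                \<comment> \<open>Membership of \<open>\<alpha>\<close> in the spread yields an
                  initial part of length \<open>n\<close> on which \<open>\<beta>\<close> vanishes;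
                  it is equal to \<open>a\<close>, so \<open>\<alpha>\<close> cannot have left the
                  spread.\<close>
                proof (rule hexE[OF hallD[OF order.trans[OF xr F[unfolded F_set_def]], of n]])
                  fix a' y assume yx: "y \<le> x" and a': "y \<le> (init \<alpha> n a' \<^bold>\<and> zero_at \<beta> a')"
                  have yr: "y \<le> r" and yv: "y \<le> v" using yx xr xv by simp_all
                  show "y \<le> ?goal"
                  proof (rule init_unique[OF order.trans[OF yr \<alpha>] order.trans[OF yv a] hconjD1[OF a']])
                    assume "a = a'"
                    then show "y \<le> ?goal"
                      using zero_nonzero_absurd[OF order.trans[OF yr b(1)] hconjD2[OF a']]
                        order.trans[OF yx nz] by blast
                  qed
                qed
              next
                fix x assume xv: "x \<le> v"
                  and "x \<le> (\<^bold>\<exists>j. tv (j < length g) \<^bold>\<and> tv (g ! j \<le> length g) \<^bold>\<and>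
                    init (subseq \<delta> j) (g ! j) (take (g ! j) a))"
                from this(2) show "x \<le> ?goal"
                proof (rule hexE)
                  fix j y
                  assume yx: "y \<le> x" and "y \<le> (tv (j < length g) \<^bold>\<and> tv (g ! j \<le> length g) \<^bold>\<and>
                    init (subseq \<delta> j) (g ! j) (take (g ! j) a))"
                  then have j: "y \<le> tv (j < length g)" "y \<le> tv (g ! j \<le> length g)"
                    and d: "y \<le> init (subseq \<delta> j) (g ! j) (take (g ! j) a)" by simp_all
                  have yv: "y \<le> v" using yx xv by (rule order.trans)
                  show "y \<le> ?goal"
                  proof (rule tvE[OF j(1)], rule tvE[OF j(2)])
                    assume j: "j < length g" "g ! j \<le> length g"
                    have "y \<le> same_init \<alpha> (subseq \<delta> j) (g ! j)"
                      using init_take[OF order.trans[OF yv a]] j l d by (intro same_initI) auto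
                    moreover have "y \<le> ?E i (g ! i) (s ! i)" if "i < length g" for i
                      using order.trans[OF yv hconjD1[OF at[of i]]] that l ls
                      by (simp add: a_def g_def tvI)
                    moreover have "y \<le> init \<gamma> (length g) g" "y \<le> admits \<sigma> s"
                      using yv g ad l by (auto intro: order.trans)
                    ultimately show "y \<le> ?goal"
                      using j l ls by (intro secured_alongI[where E = ?E and w = g and s = s and j = j]) auto
                  qed
                qed
              qed
            qed
          qed
        qed
      qed (use \<alpha> b order.trans[OF rq \<sigma>] order.trans[OF rq hconjD1[OF *]] in auto)
    qed
    then have "q \<le> (\<^bold>\<forall>\<N> \<alpha>. F_set \<beta> \<alpha> \<^bold>\<longrightarrow> perhaps \<sigma> (En \<delta>) \<alpha>)"
      by (intro sallI himpI) (meson order.trans)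
    then show "q \<le> (\<^bold>\<exists>\<N> \<tau>. Stp \<tau> \<^bold>\<and> (\<^bold>\<forall>\<N> \<alpha>. F_set \<beta> \<alpha> \<^bold>\<longrightarrow> perhaps \<tau> (En \<delta>) \<alpha>))"
      using \<sigma> hconjD1[OF *] by (intro sexI[of _ \<sigma>] inf_greatest)
  qed
qed

section \<open>Comparison of the two classes of spread-laws\<close>

lemma ACS_PCS:
  assumes bt: "valid (brouwer_thesis :: 'h::complete_heyting_algebra)"
    and b: "p \<le> baire (\<beta> :: 'h seq)" and acs: "p \<le> ACS \<beta>"
  shows "p \<le> (\<^bold>\<exists>\<N> \<sigma>. Stp \<sigma> \<^bold>\<and> PCS \<sigma> \<beta>)"
proof (rule sexE[OF hconjD2[OF acs[unfolded ACS_def]]])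
  fix \<delta> q assume qp: "q \<le> p" and \<delta>: "q \<le> baire \<delta>" and sub: "q \<le> (\<^bold>\<forall>\<N> \<alpha>. F_set \<beta> \<alpha> \<^bold>\<longrightarrow> Almost \<delta> \<alpha>)"
  have sp: "q \<le> spread_law \<beta>"
    using order.trans[OF qp hconjD1[OF acs[unfolded ACS_def]]] .
  show "q \<le> (\<^bold>\<exists>\<N> \<sigma>. Stp \<sigma> \<^bold>\<and> PCS \<sigma> \<beta>)"
  \<comment> \<open>The enumeration \<open>\<delta>\<close> is kept; the uniform stump
    \<open>\<tau>\<close> places \<open>\<beta>\<close> in a single class
    \<open>PCS \<tau>\<close>.\<close>
  proof (rule sexE[OF spread_Almost_perhaps[OF bt order.trans[OF qp b] \<delta> sp sub]])
    fix \<tau> r assume rq: "r \<le> q" and \<tau>: "r \<le> baire \<tau>"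
      and *: "r \<le> (Stp \<tau> \<^bold>\<and> (\<^bold>\<forall>\<N> \<alpha>. F_set \<beta> \<alpha> \<^bold>\<longrightarrow> perhaps \<tau> (En \<delta>) \<alpha>))"
    have "r \<le> PCS \<tau> \<beta>"
      unfolding PCS_def using order.trans[OF rq sp] order.trans[OF rq \<delta>] hconjD2[OF *]
      by (intro inf_greatest sexI[of _ \<delta>])
    then show "r \<le> (\<^bold>\<exists>\<N> \<sigma>. Stp \<sigma> \<^bold>\<and> PCS \<sigma> \<beta>)"
      using \<tau> hconjD1[OF *] by (intro sexI[of _ \<tau>] inf_greatest)
  qed
qed

text \<open>Again with the same \<open>\<delta>\<close>: \<open>perhaps_Almost\<close> is applied to
  each member of the spread separately.\<close>

lemma PCS_ACS:
  assumes \<sigma>: "p \<le> baire \<sigma>" "p \<le> Stp \<sigma>" and pcs: "p \<le> PCS \<sigma> \<beta>"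
  shows "p \<le> ACS \<beta>"
proof (rule sexE[OF hconjD2[OF pcs[unfolded PCS_def]]])
  fix \<delta> q assume qp: "q \<le> p" and \<delta>: "q \<le> baire \<delta>"
    and sub: "q \<le> (\<^bold>\<forall>\<N> \<alpha>. F_set \<beta> \<alpha> \<^bold>\<longrightarrow> perhaps \<sigma> (En \<delta>) \<alpha>)"
  note \<sigma> = \<sigma>[THEN order.trans[OF qp]]
  have "q \<le> (\<^bold>\<forall>\<N> \<alpha>. F_set \<beta> \<alpha> \<^bold>\<longrightarrow> Almost \<delta> \<alpha>)"
  proof (rule sallI, rule himpI)
    fix \<alpha> r u assume rq: "r \<le> q" and \<alpha>: "r \<le> baire \<alpha>" and ur: "u \<le> r" and F: "u \<le> F_set \<beta> \<alpha>"
    have uq: "u \<le> q" using ur rq by (rule order.trans)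
    have "u \<le> perhaps \<sigma> (En \<delta>) \<alpha>"
      by (rule himp_mp[OF sallD[OF order.trans[OF uq sub] order.trans[OF ur \<alpha>]] F])
    then show "u \<le> Almost \<delta> \<alpha>"
      using \<delta> \<sigma> \<alpha> uq ur by (intro perhaps_Almost[of u \<delta> \<alpha> \<sigma>]) (auto intro: order.trans)
  qed
  then show "q \<le> ACS \<beta>"
    unfolding ACS_def using order.trans[OF qp hconjD1[OF pcs[unfolded PCS_def]]] \<delta>
    by (intro inf_greatest sexI[of _ \<delta>])
qed

theorem theorem9p3:
  assumes "valid (brouwer_thesis :: 'h::complete_heyting_algebra)"
  shows
   "valid (\<^bold>\<forall>\<N> \<sigma> :: 'h seq. Stp \<sigma> \<^bold>\<longrightarrow>
      (\<^bold>\<forall>\<N> \<delta> \<alpha>. secures \<sigma> \<delta> \<alpha> \<^bold>\<longrightarrow> perhaps \<sigma> (En \<delta>) \<alpha>)) \<and>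
    valid (\<^bold>\<forall>\<N> (\<delta> :: 'h seq) \<alpha>. Almost \<delta> \<alpha> \<^bold>\<longrightarrow>
      (\<^bold>\<exists>\<N> \<sigma>. Stp \<sigma> \<^bold>\<and> perhaps \<sigma> (En \<delta>) \<alpha>)) \<and>
    valid (\<^bold>\<forall>\<N> (\<delta> :: 'h seq) \<alpha>. Almost \<delta> \<alpha> \<^bold>\<longleftrightarrow>
      (\<^bold>\<exists>\<N> \<sigma>. Stp \<sigma> \<^bold>\<and> perhaps \<sigma> (En \<delta>) \<alpha>)) \<and>
    valid (\<^bold>\<forall>\<N> (\<beta> :: 'h seq) \<delta>.
      (\<^bold>\<forall>s. zero_at \<beta> s \<^bold>\<longleftrightarrow> (\<^bold>\<exists>n. zero_at \<beta> (s @ [n]))) \<^bold>\<and>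
      (\<^bold>\<forall>\<N> \<alpha>. F_set \<beta> \<alpha> \<^bold>\<longrightarrow> Almost \<delta> \<alpha>) \<^bold>\<longrightarrow>
      (\<^bold>\<exists>\<N> \<tau>. Stp \<tau> \<^bold>\<and> (\<^bold>\<forall>\<N> \<alpha>. F_set \<beta> \<alpha> \<^bold>\<longrightarrow> perhaps \<tau> (En \<delta>) \<alpha>))) \<and>
    valid (\<^bold>\<forall>\<N> \<beta> :: 'h seq. ACS \<beta> \<^bold>\<longleftrightarrow> (\<^bold>\<exists>\<N> \<sigma>. Stp \<sigma> \<^bold>\<and> PCS \<sigma> \<beta>))"
proof (intro conjI)
  show "valid (\<^bold>\<forall>\<N> \<sigma> :: 'h seq. Stp \<sigma> \<^bold>\<longrightarrow>
      (\<^bold>\<forall>\<N> \<delta> \<alpha>. secures \<sigma> \<delta> \<alpha> \<^bold>\<longrightarrow> perhaps \<sigma> (En \<delta>) \<alpha>))"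
    by (intro validI sallI himpI, rule secures_perhaps) (auto intro: order.trans)
  show "valid (\<^bold>\<forall>\<N> (\<delta> :: 'h seq) \<alpha>. Almost \<delta> \<alpha> \<^bold>\<longrightarrow>
      (\<^bold>\<exists>\<N> \<sigma>. Stp \<sigma> \<^bold>\<and> perhaps \<sigma> (En \<delta>) \<alpha>))"
    by (intro validI sallI himpI, rule Almost_perhaps[OF assms]) (auto intro: order.trans)
  show "valid (\<^bold>\<forall>\<N> (\<delta> :: 'h seq) \<alpha>. Almost \<delta> \<alpha> \<^bold>\<longleftrightarrow>
      (\<^bold>\<exists>\<N> \<sigma>. Stp \<sigma> \<^bold>\<and> perhaps \<sigma> (En \<delta>) \<alpha>))"
    unfolding hiff_def
    by (intro validI sallI himpI inf_greatest, rule Almost_perhaps[OF assms])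
       (auto intro: order.trans elim!: sexE intro!: perhaps_Almost)
  show "valid (\<^bold>\<forall>\<N> (\<beta> :: 'h seq) \<delta>.
      (\<^bold>\<forall>s. zero_at \<beta> s \<^bold>\<longleftrightarrow> (\<^bold>\<exists>n. zero_at \<beta> (s @ [n]))) \<^bold>\<and>
      (\<^bold>\<forall>\<N> \<alpha>. F_set \<beta> \<alpha> \<^bold>\<longrightarrow> Almost \<delta> \<alpha>) \<^bold>\<longrightarrow>
      (\<^bold>\<exists>\<N> \<tau>. Stp \<tau> \<^bold>\<and> (\<^bold>\<forall>\<N> \<alpha>. F_set \<beta> \<alpha> \<^bold>\<longrightarrow> perhaps \<tau> (En \<delta>) \<alpha>)))"
    \<comment> \<open>The condition on \<open>\<beta>\<close> that the statement writes out is
      folded back into \<open>spread_law\<close>.\<close>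
    unfolding spread_law_def[symmetric]
    by (intro validI sallI himpI, rule spread_Almost_perhaps[OF assms]) (auto intro: order.trans)
  show "valid (\<^bold>\<forall>\<N> \<beta> :: 'h seq. ACS \<beta> \<^bold>\<longleftrightarrow> (\<^bold>\<exists>\<N> \<sigma>. Stp \<sigma> \<^bold>\<and> PCS \<sigma> \<beta>))"
    unfolding hiff_def
    by (intro validI sallI himpI inf_greatest, rule ACS_PCS[OF assms])
       (auto intro: order.trans elim!: sexE intro!: PCS_ACS)
qed

end
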